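(* Let $(A,\phi,t,S)$ be a bi-Frobenius algebra structure on a quantum complete intersection $A=A(\mathbf q,\mathbf a)$ over a field $\mathbb K$, with counit $\varepsilon$, right modular function $\alpha$ and right modular element $\mathfrak a$. Then: (i) $\phi=x_{\mathbf a-\mathbf 1}^*\leftharpoonup z$ for some $z\in U(A)$; and $\phi=\sum_{\mathbf v\in V}c_{\mathbf v}x_{\mathbf v}^*$ with $c_{\mathbf v}\in\mathbb K$ and $c_{\mathbf a-\mathbf 1}\ne0$. (ii) $\alpha=\varepsilon$; and $\varepsilon(x_{\mathbf v})=\delta_{\mathbf v,\mathbf 0}$ for $\mathbf v\in V$. (iii) $t=cx_{\mathbf a-\mathbf 1}$ with $c\in\mathbb K\setminus\{0\}$; and $A$ is unimodular with the space of right integrals $\mathbb Kx_{\mathbf a-\mathbf 1}$. (iv) $\mathcal N^2=\mathrm{Id}$, i.e. $h_{\mathbf e_i}^2=1$ for $1\le i\le n$, where $\mathcal N$ is the canonical Nakayama automorphism of $A$. (v) If $S$ is a graded map, then $S^2=\mathcal N$ and $S^4=\mathrm{Id}$. (vi) If $\mathrm{Char}\,\mathbb K=0$, then $\mathfrak a=1$, $\mathcal N_\phi^2=\mathrm{Id}$ and $S^4=\mathrm{Id}$.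
   Context: **Quantum complete intersections.** Let $\mathbb K$ be a field, $n\ge 2$ an integer, $\mathbf a=(a_1,\dots,a_n)$ an integer vector with all $a_i\ge 2$, and $\mathbf q=(q_{ij})$ an $n\times n$ matrix over $\mathbb K$ with $q_{ii}=1$ and $q_{ij}q_{ji}=1$ for all $i,j$. The quantum complete intersection $A=A(\mathbf q,\mathbf a)$ is the $\mathbb K$-algebra $\mathbb K\langle x_1,\dots,x_n\rangle/\langle x_i^{a_i},\ x_jx_i-q_{ij}x_ix_j,\ 1\le i,j\le n\rangle$. Put $V=\{\mathbf v\in\mathbb N_0^n: v_i\le a_i-1,\ 1\le i\le n\}$ and $x_{\mathbf v}=x_1^{v_1}\cdots x_n^{v_n}$. Then $\{x_{\mathbf v}:\mathbf v\in V\}$ is a $\mathbb K$-basis of $A$ (the standard basis); $\{x_{\mathbf v}^*\}$ is the dual basis of $A^*=\mathrm{Hom}_{\mathbb K}(A,\mathbb K)$. The degree of $x_{\mathbf v}$ is $|x_{\mathbf v}|=\sum_iv_i$; this makes $A$ an $\mathbb N_0$-graded algebra. A linear map $S:A\to A$ is graded if it preserves the degrees of all $x_{\mathbf v}$, $\mathbf v\in V$ (i.e. $S(x_{\mathbf v})$ is homogeneous of degree $|x_{\mathbf v}|$). Write $\mathbf 0=(0,\dots,0)$, $\mathbf 1=(1,\dots,1)$, $\mathbf e_i$ for the $i$-th unit vector, and $U(A)$ for the set of invertible elements of $A$. **Structure coefficients and Nakayama automorphisms.** For $\mathbf u,\mathbf v\in\mathbb Z^n$: $\mathbf q^{\langle\mathbf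 u|\mathbf v\rangle}=\prod_{1\le i<j\le n}q_{ij}^{u_jv_i}$ and $h_{\mathbf v}=\mathbf q^{\langle\mathbf a-\mathbf 1-\mathbf v|\mathbf v\rangle}/\mathbf q^{\langle\mathbf v|\mathbf a-\mathbf 1-\mathbf v\rangle}$; in particular $h_{\mathbf e_i}=\prod_jq_{ij}^{a_j-1}$. For a Frobenius form $\phi$, $\mathcal N_\phi:A\to A$ is the unique algebra automorphism with $\phi(xy)=\phi(y\mathcal N_\phi(x))$ for all $x,y\in A$. The canonical Nakayama automorphism is $\mathcal N=\mathcal N_{x^*_{\mathbf a-\mathbf 1}}$; it is given by $\mathcal N(x_{\mathbf v})=h_{\mathbf v}x_{\mathbf v}$, $\mathbf v\in V$. **Actions.** $A^*$ is an $A$-$A$-bimodule by $(a\rightharpoonup f\leftharpoonup b)(x)=f(bxa)$. If $A$ is a coalgebra, $A^*$ is the dual algebra and it acts on $A$ by $f\rightharpoonup c=\sum c_1f(c_2)$ and $c\leftharpoonup f=\sum f(c_1)c_2$ (Sweedler notation $\Delta(c)=\sum c_1\otimes c_2$). **Bi-Frobenius algebras.** Let $A$ be a finite-dimensional algebra which is also a coalgebra $(A,\Delta,\varepsilon)$ over $\mathbb K$, let $t\in A$, $\phi\in A^*$, and let $S:A\to A$ be the linear map $S(a)=\sum\phi(t_1a)t_2$. $(A,\phi,t,S)$ is a bi-Frobenius algebra (with antipode $S$) if: (i) $\varepsilon$ is an algebra homomorphism and $\Delta(1_A)=1_A\otimes 1_A$; (ii) $(A,\phi)$ is a Frobenius algebra,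 i.e. $A^*=\phi\leftharpoonup A$ ($\phi$ is then called a Frobenius form), and $(A,t)$ is a Frobenius coalgebra, i.e. $A=t\leftharpoonup A^*$; (iii) $S$ is an algebra anti-homomorphism ($S(1)=1$, $S(ab)=S(b)S(a)$) and a coalgebra anti-homomorphism ($\varepsilon\circ S=\varepsilon$, $\Delta(S(a))=\sum S(a_2)\otimes S(a_1)$). **Modular function, modular element, integrals.** For a bi-Frobenius algebra $(A,\phi,t,S)$, the right modular function is $\alpha=t\rightharpoonup\phi\in A^*$ and the right modular element is $\mathfrak a=\phi\rightharpoonup t\in A$. An element $s\in A$ is a right (resp. left) integral if $sx=s\varepsilon(x)$ (resp. $xs=\varepsilon(x)s$) for all $x\in A$; $A$ is unimodular if the spaces of right and of left integrals coincide. *)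

theory Defs
  imports Complex_Main "HOL-Library.Poly_Mapping" "HOL-Library.Cardinality"
begin

section \<open>Algebras over a field and linear extension\<close>

text \<open>Associative unital algebras over a field, with scalar multiplication \<open>scale\<close>. The
  algebra is a whole type, so all its linear maps and functionals are total functions.\<close>

locale k_algebra = vector_space scale
  for scale :: "'k::field \<Rightarrow> 'a::ring_1 \<Rightarrow> 'a" +
  assumes scale_mult_left: "scale c x * y = scale c (x * y)"
    and scale_mult_right: "x * scale c y = scale c (x * y)"

definition linear_functional :: "('k::field \<Rightarrow> 'a::ring_1 \<Rightarrow> 'a) \<Rightarrow> ('a \<Rightarrow> 'k) \<Rightarrow> bool" where
  "linear_functional scale f \<longleftrightarrow> Vector_Spaces.linear scale (*) f"

definition algebra_automorphism :: "('k::field \<Rightarrow> 'a::ring_1 \<Rightarrow> 'a) \<Rightarrow> ('a \<Rightarrow> 'a) \<Rightarrow> bool" where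
  "algebra_automorphism scale N \<longleftrightarrow>
     Vector_Spaces.linear scale scale N \<and> N 1 = 1 \<and> (\<forall>x y. N (x * y) = N x * N y) \<and> bij N"

definition unit_elements :: "'a::ring_1 set" where
  "unit_elements = {z. \<exists>w. z * w = 1 \<and> w * z = 1}"

definition two_sided_ideal :: "'a::ring_1 set \<Rightarrow> bool" where
  "two_sided_ideal I \<longleftrightarrow>
     0 \<in> I \<and> (\<forall>x\<in>I. \<forall>y\<in>I. x + y \<in> I) \<and> (\<forall>x\<in>I. \<forall>r. r * x \<in> I \<and> x * r \<in> I)"

text \<open>\<open>'b \<Rightarrow>\<^sub>0 'k\<close> is the vector space with basis \<open>'b\<close>; \<open>lin_ext\<close> extends a map on the basis
  linearly to a vector space with scalar multiplication \<open>sc\<close>.\<close>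

definition fscale :: "'k::field \<Rightarrow> ('b \<Rightarrow>\<^sub>0 'k) \<Rightarrow> ('b \<Rightarrow>\<^sub>0 'k)" where
  "fscale k p = Poly_Mapping.map ((*) k) p"

definition lin_ext :: "('k::field \<Rightarrow> 'w::ab_group_add \<Rightarrow> 'w) \<Rightarrow> ('b \<Rightarrow> 'w) \<Rightarrow> ('b \<Rightarrow>\<^sub>0 'k) \<Rightarrow> 'w" where
  "lin_ext sc g p = (\<Sum>b\<in>Poly_Mapping.keys p. sc (Poly_Mapping.lookup p b) (g b))"

lemma lookup_fscale: "Poly_Mapping.lookup (fscale k p) b = k * Poly_Mapping.lookup p b"
  by (cases "Poly_Mapping.lookup p b = 0") (simp_all add: fscale_def Poly_Mapping.map.rep_eq)

lemma vector_space_fscale: "vector_space fscale"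
  by unfold_locales (auto intro!: poly_mapping_eqI simp: lookup_fscale lookup_add algebra_simps)


section \<open>Quantum complete intersections\<close>

text \<open>The free monoid on \<open>'i\<close>, written additively so that \<open>'i fmon \<Rightarrow>\<^sub>0 'k\<close>, with the
  convolution product of \<^theory>\<open>HOL-Library.Poly_Mapping\<close>, is the free associative algebra on
  \<open>'i\<close>.\<close>

datatype 'i fmon = Word (letters: "'i list")

instantiation fmon :: (type) monoid_add
begin

definition zero_fmon :: "'a fmon" where
  "0 = Word []"

definition plus_fmon :: "'a fmon \<Rightarrow> 'a fmon \<Rightarrow> 'a fmon" where
  "u + v = Word (letters u @ letters v)"

instance
  by standard (simp_all add: zero_fmon_def plus_fmon_def)

end

type_synonym ('k, 'i) free_algebra = "'i fmon \<Rightarrow>\<^sub>0 'k"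

definition gen :: "'i \<Rightarrow> ('k::field, 'i) free_algebra" where
  "gen i = Poly_Mapping.single (Word [i]) 1"

text \<open>The algebra homomorphism from the free algebra that sends \<open>gen i\<close> to \<open>x i\<close>.\<close>

definition free_eval ::
    "('k::field \<Rightarrow> 'a::ring_1 \<Rightarrow> 'a) \<Rightarrow> ('i \<Rightarrow> 'a) \<Rightarrow> ('k, 'i) free_algebra \<Rightarrow> 'a" where
  "free_eval scale x = lin_ext scale (\<lambda>w. prod_list (map x (letters w)))"

definition qci_relations ::
    "('i \<Rightarrow> 'i \<Rightarrow> 'k::field) \<Rightarrow> ('i \<Rightarrow> nat) \<Rightarrow> ('k, 'i) free_algebra set" where
  "qci_relations q a =
     {gen i ^ a i | i. True} \<union> {gen j * gen i - fscale (q i j) (gen i * gen j) | i j. True}"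

text \<open>The algebra is the quotient of the free algebra by the ideal of the relations, with \<open>x i\<close>
  the class of the \<open>i\<close>-th generator: the canonical map from the free algebra is onto and its
  kernel is that ideal. A quotient depending on \<open>q\<close> and \<open>a\<close> cannot be a type, so it is
  described in this way, up to isomorphism.\<close>

definition quantum_complete_intersection ::
    "('k::field \<Rightarrow> 'a::ring_1 \<Rightarrow> 'a) \<Rightarrow> ('i \<Rightarrow> 'a) \<Rightarrow> ('i \<Rightarrow> 'i \<Rightarrow> 'k) \<Rightarrow> ('i \<Rightarrow> nat) \<Rightarrow> bool" where
  "quantum_complete_intersection scale x q a \<longleftrightarrow>
     k_algebra scale \<and> surj (free_eval scale x) \<and>
     {p. free_eval scale x p = 0} = two_sided_ideal hull (qci_relations q a)"

text \<open>Multi-indices are functions on a finite linearly ordered index type \<open>'i\<close>, which plays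
  the role of \<open>{1,\<dots>,n}\<close>.\<close>

definition exponents :: "('i \<Rightarrow> nat) \<Rightarrow> ('i \<Rightarrow> nat) set" where
  "exponents a = {v. \<forall>i. v i \<le> a i - 1}"

definition top_exponent :: "('i \<Rightarrow> nat) \<Rightarrow> 'i \<Rightarrow> nat" where
  "top_exponent a = (\<lambda>i. a i - 1)"

definition std_monomial :: "('i::{finite,linorder} \<Rightarrow> 'a::ring_1) \<Rightarrow> ('i \<Rightarrow> nat) \<Rightarrow> 'a" where
  "std_monomial x v = prod_list (map (\<lambda>i. x i ^ v i) (sorted_list_of_set UNIV))"

text \<open>\<open>dual_monomial scale x a v\<close> is the functional taking the coefficient at \<open>x\<^sub>v\<close> in the
  standard basis.\<close>

definition dual_monomial ::
    "('k::field \<Rightarrow> 'a::ring_1 \<Rightarrow> 'a) \<Rightarrow> ('i::{finite,linorder} \<Rightarrow> 'a) \<Rightarrow> ('i \<Rightarrow> nat) \<Rightarrow>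
     ('i \<Rightarrow> nat) \<Rightarrow> 'a \<Rightarrow> 'k" where
  "dual_monomial scale x a v y =
     module.representation scale (std_monomial x ` exponents a) y (std_monomial x v)"

definition graded_map ::
    "('k::field \<Rightarrow> 'a::ring_1 \<Rightarrow> 'a) \<Rightarrow> ('i::{finite,linorder} \<Rightarrow> 'a) \<Rightarrow> ('i \<Rightarrow> nat) \<Rightarrow>
     ('a \<Rightarrow> 'a) \<Rightarrow> bool" where
  "graded_map scale x a S \<longleftrightarrow>
     (\<forall>v\<in>exponents a. S (std_monomial x v) \<in>
        module.span scale {std_monomial x u | u. u \<in> exponents a \<and> sum u UNIV = sum v UNIV})"

definition q_pairing ::
    "('i::{finite,linorder} \<Rightarrow> 'i \<Rightarrow> 'k::field) \<Rightarrow> ('i \<Rightarrow> int) \<Rightarrow> ('i \<Rightarrow> int) \<Rightarrow> 'k" where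
  "q_pairing q u v = (\<Prod>(i, j)\<in>{(i, j). i < j}. q i j powi (u j * v i))"

definition h_coeff ::
    "('i::{finite,linorder} \<Rightarrow> 'i \<Rightarrow> 'k::field) \<Rightarrow> ('i \<Rightarrow> nat) \<Rightarrow> ('i \<Rightarrow> int) \<Rightarrow> 'k" where
  "h_coeff q a v =
     q_pairing q (\<lambda>i. int (a i) - 1 - v i) v / q_pairing q v (\<lambda>i. int (a i) - 1 - v i)"

definition unit_vector :: "'i \<Rightarrow> 'i \<Rightarrow> int" where
  "unit_vector i = (\<lambda>j. if j = i then 1 else 0)"


section \<open>Tensor products and coalgebras\<close>

text \<open>\<open>A \<otimes> A\<close> is the vector space with basis \<open>A \<times> A\<close> modulo the bilinearity relations, and
  similarly for \<open>A \<otimes> A \<otimes> A\<close>. A tensor is handled through a representing formal sum of pairs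
  or triples, and \<open>tensor2_eq\<close>, \<open>tensor3_eq\<close> are equality in the tensor product. In this way a
  comultiplication assigns to every element a formal sum representing its image; every map
  \<open>A \<rightarrow> A \<otimes> A\<close> is obtained, and what follows does not depend on the representatives.\<close>

abbreviation pure :: "'b \<Rightarrow> 'b \<Rightarrow>\<^sub>0 'k::field" where
  "pure b \<equiv> Poly_Mapping.single b 1"

definition tensor2_relations ::
    "('k::field \<Rightarrow> 'a::ring_1 \<Rightarrow> 'a) \<Rightarrow> ('a \<times> 'a \<Rightarrow>\<^sub>0 'k) set" where
  "tensor2_relations scale =
     {pure (x + x', y) - pure (x, y) - pure (x', y) | x x' y. True} \<union>
     {pure (x, y + y') - pure (x, y) - pure (x, y') | x y y'. True} \<union>
     {pure (scale c x, y) - fscale c (pure (x, y)) | c x y. True} \<union>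
     {pure (x, scale c y) - fscale c (pure (x, y)) | c x y. True}"

definition tensor2_eq ::
    "('k::field \<Rightarrow> 'a::ring_1 \<Rightarrow> 'a) \<Rightarrow> ('a \<times> 'a \<Rightarrow>\<^sub>0 'k) \<Rightarrow> ('a \<times> 'a \<Rightarrow>\<^sub>0 'k) \<Rightarrow> bool" where
  "tensor2_eq scale p p' \<longleftrightarrow> p - p' \<in> module.span fscale (tensor2_relations scale)"

definition tensor3_relations ::
    "('k::field \<Rightarrow> 'a::ring_1 \<Rightarrow> 'a) \<Rightarrow> ('a \<times> 'a \<times> 'a \<Rightarrow>\<^sub>0 'k) set" where
  "tensor3_relations scale =
     {pure (x + x', y, z) - pure (x, y, z) - pure (x', y, z) | x x' y z. True} \<union>
     {pure (x, y + y', z) - pure (x, y, z) - pure (x, y', z) | x y y' z. True} \<union>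
     {pure (x, y, z + z') - pure (x, y, z) - pure (x, y, z') | x y z z'. True} \<union>
     {pure (scale c x, y, z) - fscale c (pure (x, y, z)) | c x y z. True} \<union>
     {pure (x, scale c y, z) - fscale c (pure (x, y, z)) | c x y z. True} \<union>
     {pure (x, y, scale c z) - fscale c (pure (x, y, z)) | c x y z. True}"

definition tensor3_eq ::
    "('k::field \<Rightarrow> 'a::ring_1 \<Rightarrow> 'a) \<Rightarrow>
     ('a \<times> 'a \<times> 'a \<Rightarrow>\<^sub>0 'k) \<Rightarrow> ('a \<times> 'a \<times> 'a \<Rightarrow>\<^sub>0 'k) \<Rightarrow> bool" where
  "tensor3_eq scale p p' \<longleftrightarrow> p - p' \<in> module.span fscale (tensor3_relations scale)"

text \<open>Sweedler sums: \<open>lin_ext sc (\<lambda>(x, y). B x y) (\<Delta> c)\<close> is \<open>\<Sum> B c\<^sub>1 c\<^sub>2\<close>.\<close>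

definition coalgebra ::
    "('k::field \<Rightarrow> 'a::ring_1 \<Rightarrow> 'a) \<Rightarrow> ('a \<Rightarrow> ('a \<times> 'a \<Rightarrow>\<^sub>0 'k)) \<Rightarrow> ('a \<Rightarrow> 'k) \<Rightarrow> bool" where
  "coalgebra scale \<Delta> \<epsilon> \<longleftrightarrow>
     (\<forall>c d. tensor2_eq scale (\<Delta> (c + d)) (\<Delta> c + \<Delta> d)) \<and>
     (\<forall>k c. tensor2_eq scale (\<Delta> (scale k c)) (fscale k (\<Delta> c))) \<and>
     linear_functional scale \<epsilon> \<and>
     (\<forall>c. tensor3_eq scale
            (lin_ext fscale (\<lambda>(x, y). lin_ext fscale (\<lambda>(x1, x2). pure (x1, x2, y)) (\<Delta> x)) (\<Delta> c))
            (lin_ext fscale (\<lambda>(x, y). lin_ext fscale (\<lambda>(y1, y2). pure (x, y1, y2)) (\<Delta> y)) (\<Delta> c))) \<and>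
     (\<forall>c. lin_ext scale (\<lambda>(x, y). scale (\<epsilon> x) y) (\<Delta> c) = c) \<and>
     (\<forall>c. lin_ext scale (\<lambda>(x, y). scale (\<epsilon> y) x) (\<Delta> c) = c)"


section \<open>Actions and bi-Frobenius algebras\<close>

definition dual_lact :: "'a::ring_1 \<Rightarrow> ('a \<Rightarrow> 'k) \<Rightarrow> 'a \<Rightarrow> 'k" (infixr \<open>\<rightharpoonup>\<^sub>d\<close> 65) where
  "b \<rightharpoonup>\<^sub>d f = (\<lambda>x. f (x * b))"

definition dual_ract :: "('a::ring_1 \<Rightarrow> 'k) \<Rightarrow> 'a \<Rightarrow> 'a \<Rightarrow> 'k" (infixl \<open>\<leftharpoonup>\<^sub>d\<close> 65) where
  "f \<leftharpoonup>\<^sub>d b = (\<lambda>x. f (b * x))"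

text \<open>The two actions of the dual algebra, \<open>f \<rightharpoonup> c = \<Sum> c\<^sub>1 f(c\<^sub>2)\<close> and
  \<open>c \<leftharpoonup> f = \<Sum> f(c\<^sub>1) c\<^sub>2\<close>.\<close>

definition coalg_lact ::
    "('k::field \<Rightarrow> 'a::ring_1 \<Rightarrow> 'a) \<Rightarrow> ('a \<Rightarrow> ('a \<times> 'a \<Rightarrow>\<^sub>0 'k)) \<Rightarrow> ('a \<Rightarrow> 'k) \<Rightarrow> 'a \<Rightarrow> 'a" where
  "coalg_lact scale \<Delta> f c = lin_ext scale (\<lambda>(x, y). scale (f y) x) (\<Delta> c)"

definition coalg_ract ::
    "('k::field \<Rightarrow> 'a::ring_1 \<Rightarrow> 'a) \<Rightarrow> ('a \<Rightarrow> ('a \<times> 'a \<Rightarrow>\<^sub>0 'k)) \<Rightarrow> 'a \<Rightarrow> ('a \<Rightarrow> 'k) \<Rightarrow> 'a" where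
  "coalg_ract scale \<Delta> c f = lin_ext scale (\<lambda>(x, y). scale (f x) y) (\<Delta> c)"

definition frobenius_form :: "('k::field \<Rightarrow> 'a::ring_1 \<Rightarrow> 'a) \<Rightarrow> ('a \<Rightarrow> 'k) \<Rightarrow> bool" where
  "frobenius_form scale \<phi> \<longleftrightarrow> linear_functional scale \<phi> \<and>
     {f. linear_functional scale f} = {\<phi> \<leftharpoonup>\<^sub>d b | b. True}"

definition frobenius_coalgebra ::
    "('k::field \<Rightarrow> 'a::ring_1 \<Rightarrow> 'a) \<Rightarrow> ('a \<Rightarrow> ('a \<times> 'a \<Rightarrow>\<^sub>0 'k)) \<Rightarrow> 'a \<Rightarrow> bool" where
  "frobenius_coalgebra scale \<Delta> t \<longleftrightarrow>
     UNIV = {coalg_ract scale \<Delta> t f | f. linear_functional scale f}"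

definition bi_frobenius ::
    "('k::field \<Rightarrow> 'a::ring_1 \<Rightarrow> 'a) \<Rightarrow> ('a \<Rightarrow> ('a \<times> 'a \<Rightarrow>\<^sub>0 'k)) \<Rightarrow> ('a \<Rightarrow> 'k) \<Rightarrow>
     ('a \<Rightarrow> 'k) \<Rightarrow> 'a \<Rightarrow> ('a \<Rightarrow> 'a) \<Rightarrow> bool" where
  "bi_frobenius scale \<Delta> \<epsilon> \<phi> t S \<longleftrightarrow>
     k_algebra scale \<and> (\<exists>B. finite_dimensional_vector_space scale B) \<and> coalgebra scale \<Delta> \<epsilon> \<and>
     S = (\<lambda>b. lin_ext scale (\<lambda>(t1, t2). scale (\<phi> (t1 * b)) t2) (\<Delta> t)) \<and>
     (\<epsilon> 1 = 1 \<and> (\<forall>x y. \<epsilon> (x * y) = \<epsilon> x * \<epsilon> y) \<and> tensor2_eq scale (\<Delta> 1) (pure (1, 1))) \<and>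
     frobenius_form scale \<phi> \<and> frobenius_coalgebra scale \<Delta> t \<and>
     (S 1 = 1 \<and> (\<forall>x y. S (x * y) = S y * S x) \<and>
      (\<forall>c. \<epsilon> (S c) = \<epsilon> c) \<and>
      (\<forall>c. tensor2_eq scale (\<Delta> (S c)) (lin_ext fscale (\<lambda>(c1, c2). pure (S c2, S c1)) (\<Delta> c))))"

text \<open>The Nakayama automorphism exists uniquely whenever \<open>\<phi>\<close> is a Frobenius form.\<close>

definition nakayama :: "('k::field \<Rightarrow> 'a::ring_1 \<Rightarrow> 'a) \<Rightarrow> ('a \<Rightarrow> 'k) \<Rightarrow> 'a \<Rightarrow> 'a" where
  "nakayama scale \<phi> =
     (THE N. algebra_automorphism scale N \<and> (\<forall>x y. \<phi> (x * y) = \<phi> (y * N x)))"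

definition canonical_nakayama ::
    "('k::field \<Rightarrow> 'a::ring_1 \<Rightarrow> 'a) \<Rightarrow> ('i::{finite,linorder} \<Rightarrow> 'a) \<Rightarrow> ('i \<Rightarrow> nat) \<Rightarrow> 'a \<Rightarrow> 'a"
  where
  "canonical_nakayama scale x a = nakayama scale (dual_monomial scale x a (top_exponent a))"

definition modular_function :: "('a::ring_1 \<Rightarrow> 'k::field) \<Rightarrow> 'a \<Rightarrow> 'a \<Rightarrow> 'k" where
  "modular_function \<phi> t = t \<rightharpoonup>\<^sub>d \<phi>"

definition modular_element ::
    "('k::field \<Rightarrow> 'a::ring_1 \<Rightarrow> 'a) \<Rightarrow> ('a \<Rightarrow> ('a \<times> 'a \<Rightarrow>\<^sub>0 'k)) \<Rightarrow> ('a \<Rightarrow> 'k) \<Rightarrow> 'a \<Rightarrow> 'a" where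
  "modular_element scale \<Delta> \<phi> t = coalg_lact scale \<Delta> \<phi> t"

definition right_integrals ::
    "('k::field \<Rightarrow> 'a::ring_1 \<Rightarrow> 'a) \<Rightarrow> ('a \<Rightarrow> 'k) \<Rightarrow> 'a set" where
  "right_integrals scale \<epsilon> = {s. \<forall>x. s * x = scale (\<epsilon> x) s}"

definition left_integrals ::
    "('k::field \<Rightarrow> 'a::ring_1 \<Rightarrow> 'a) \<Rightarrow> ('a \<Rightarrow> 'k) \<Rightarrow> 'a set" where
  "left_integrals scale \<epsilon> = {s. \<forall>x. x * s = scale (\<epsilon> x) s}"

definition unimodular :: "('k::field \<Rightarrow> 'a::ring_1 \<Rightarrow> 'a) \<Rightarrow> ('a \<Rightarrow> 'k) \<Rightarrow> bool" where
  "unimodular scale \<epsilon> \<longleftrightarrow> right_integrals scale \<epsilon> = left_integrals scale \<epsilon>"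

end

theory Submission
  imports Defs "HOL-Computational_Algebra.Polynomial" "HOL-Library.FuncSet"
begin

text \<open>Write \<open>f \<star> g\<close> for the product of the dual algebra \<open>A\<^sup>*\<close>. By its definition the antipode is the
  composite of \<open>A \<rightarrow> A\<^sup>*\<close>, \<open>b \<mapsto> \<phi>(\<cdot> b)\<close>, with \<open>A\<^sup>* \<rightarrow> A\<close>, \<open>f \<mapsto> \<Sum> f(t\<^sub>1) t\<^sub>2\<close>. Both are isomorphisms, so \<open>S\<close> is
  bijective, and \<open>t\<^sub>1\<close>, \<open>S\<^sup>-\<^sup>1 t\<^sub>2\<close> are dual bases for \<open>\<phi>\<close> (\<open>dual_bases\<close>). Moreover \<open>\<epsilon> \<circ> S = \<epsilon>\<close> becomes
  \<open>\<phi>(t x) = \<epsilon>(x)\<close>, so that the right integrals are the multiples of \<open>t\<close> (\<open>right_integral_iff\<close>).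

  In a quantum complete intersection the coefficient at \<open>1\<close> is the only character, its kernel is
  nilpotent, and the socle, spanned by the top monomial, consists of two-sided integrals. Hence \<open>\<epsilon>\<close> is
  that coefficient, \<open>t\<close> is a multiple of the top monomial, and \<open>\<phi>\<close> differs from the top coefficient
  by a unit. All this rests on the standard basis; its linear independence comes from coefficient
  functionals on the free algebra that vanish on the ideal of relations (\<open>word_functional_eq_0\<close>).

  Since \<open>t\<close> is a two-sided integral, \<open>S\<close> fixes it. Applying \<open>S\<close> to the dual basis expansion then
  shows that \<open>S\<^sup>-\<^sup>2\<close> is the Nakayama automorphism of \<open>\<phi>\<close> (\<open>form_nakayama\<close>). With \<open>\<phi> \<circ> S = \<phi> \<leftharpoonup> \<aa>\<close>,
  where \<open>\<aa>\<close> is the modular element, it follows that \<open>S\<^sup>4\<close> is conjugation by \<open>\<aa>\<close>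
  (\<open>antipode_square_modular\<close>). The canonical Nakayama automorphism equals \<open>S\<^sup>-\<^sup>2\<close> up to an inner
  automorphism, and inner automorphisms act trivially modulo the square of the augmentation ideal. On
  the generators the eigenvalues of the canonical Nakayama automorphism are thus equal to their own
  inverses (\<open>canonical_nakayama\<close>). If \<open>S\<close> is graded, the inner automorphism disappears in every degree,
  since only the constant term of the conjugating unit contributes to the lowest degree
  (\<open>graded_antipode_square\<close>).

  In characteristic zero it remains to see that \<open>\<aa> = 1\<close>. The comultiplication is not assumed to be
  multiplicative, so powers of group-like elements need not be group-like. But \<open>A\<^sup>*\<close> with the form
  \<open>f \<mapsto> f(t)\<close> is a Frobenius algebra too, and its Nakayama automorphism is dual to \<open>x \<mapsto> \<aa> S\<^sup>-\<^sup>2(x)\<close>, which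
  is therefore a coalgebra automorphism. Iterating it on \<open>1\<close> shows that every \<open>\<aa>\<^sup>m\<close> is group-like
  (\<open>modular_power_grouplike\<close>). As \<open>\<aa> - 1\<close> is nilpotent, \<open>f(\<aa>\<^sup>m)\<close> is a polynomial in \<open>m\<close> of bounded
  degree for each functional \<open>f\<close>, and passing to \<open>f \<star> f\<close> squares it. So all these polynomials are
  constant and \<open>\<aa> = 1\<close> (\<open>modular_element_eq_one\<close>).\<close>

section \<open>Linear extension and Sweedler sums\<close>

lemma vector_space_field: "vector_space ((*) :: 'k::field \<Rightarrow> 'k \<Rightarrow> 'k)"
  by unfold_locales (simp_all add: algebra_simps)

context vector_space
begin

lemma lin_ext_superset:
  assumes "finite A" and "Poly_Mapping.keys p \<subseteq> A"
  shows "lin_ext scale g p = (\<Sum>b\<in>A. scale (Poly_Mapping.lookup p b) (g b))"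
  unfolding lin_ext_def using assms
  by (intro sum.mono_neutral_left) (auto simp: in_keys_iff)

lemma lin_ext_add: "lin_ext scale g (p + p') = lin_ext scale g p + lin_ext scale g p'"
proof -
  define A where "A = Poly_Mapping.keys p \<union> Poly_Mapping.keys p'"
  have "finite A" "Poly_Mapping.keys p \<subseteq> A" "Poly_Mapping.keys p' \<subseteq> A"
    "Poly_Mapping.keys (p + p') \<subseteq> A"
    using Poly_Mapping.keys_add[of p p'] by (auto simp: A_def)
  then show ?thesis
    by (simp add: lin_ext_superset[of A] lookup_add scale_left_distrib sum.distrib)
qed

lemma lin_ext_fscale: "lin_ext scale g (fscale k p) = scale k (lin_ext scale g p)"
proof -
  have "Poly_Mapping.keys (fscale k p) \<subseteq> Poly_Mapping.keys p"
    by (auto simp: in_keys_iff lookup_fscale)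
  then show ?thesis
    by (simp add: lin_ext_superset[of "Poly_Mapping.keys p"] lookup_fscale scale_sum_right)
qed

lemma linear_lin_ext: "Vector_Spaces.linear fscale scale (lin_ext scale g)"
proof -
  interpret f: vector_space "fscale :: 'a \<Rightarrow> ('c \<Rightarrow>\<^sub>0 'a) \<Rightarrow> _" by (rule vector_space_fscale)
  show ?thesis by unfold_locales (simp_all add: lin_ext_add lin_ext_fscale)
qed

lemma lin_ext_diff: "lin_ext scale g (p - p') = lin_ext scale g p - lin_ext scale g p'"
  using lin_ext_add[of g "p - p'" p'] by simp

lemma lin_ext_0 [simp]: "lin_ext scale g 0 = 0"
  by (simp add: lin_ext_def)

lemma lin_ext_single [simp]: "lin_ext scale g (Poly_Mapping.single b k) = scale k (g b)"
  by (simp add: lin_ext_superset[of "{b}"])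

lemma lin_ext_sum: "lin_ext scale g (\<Sum>i\<in>I. p i) = (\<Sum>i\<in>I. lin_ext scale g (p i))"
  by (induction I rule: infinite_finite_induct) (simp_all add: lin_ext_add)

lemma lin_ext_lin_ext:
  "lin_ext scale g (lin_ext fscale h p) = lin_ext scale (\<lambda>b. lin_ext scale g (h b)) p"
  unfolding lin_ext_def[of fscale] lin_ext_def[of scale "\<lambda>b. lin_ext scale g (h b)"]
  by (simp add: lin_ext_sum lin_ext_fscale)

end

context k_algebra
begin

lemma linear_functional_iff:
  "linear_functional scale f \<longleftrightarrow> (\<forall>x y. f (x + y) = f x + f y) \<and> (\<forall>c x. f (scale c x) = c * f x)"
  unfolding linear_functional_def Vector_Spaces.linear_def module_hom_def module_hom_axioms_def
  by (simp add: module_iff_vector_space vector_space_axioms vector_space_field)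

lemma linear_functional_sum:
  assumes "linear_functional scale f"
  shows "f (\<Sum>i\<in>I. y i) = (\<Sum>i\<in>I. f (y i))"
proof -
  interpret f: Vector_Spaces.linear scale "(*)" f
    using assms by (simp add: linear_functional_def)
  show ?thesis by (rule f.sum)
qed

lemma linear_functional_lin_ext:
  assumes "linear_functional scale f"
  shows "f (lin_ext scale g p) = lin_ext (*) (\<lambda>b. f (g b)) p"
  using assms by (simp add: lin_ext_def linear_functional_sum linear_functional_iff)

text \<open>A nonzero vector can be extended to a basis, and its coordinate does not kill it.\<close>

lemma functionals_separate_points:
  assumes "\<And>f. linear_functional scale f \<Longrightarrow> f b = 0"
  shows "b = 0"
proof (rule ccontr)
  assume "b \<noteq> 0"
  then have ind: "independent {b}"
    by (simp add: dependent_single)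
  let ?B = "extend_basis {b}"
  have B: "independent ?B" "span ?B = UNIV" "b \<in> ?B"
    using independent_extend_basis[OF ind] span_extend_basis[OF ind] extend_basis_superset[OF ind]
    by auto
  have "linear_functional scale (\<lambda>v. representation ?B v b)"
    unfolding linear_functional_def by (rule linear_representation[OF B(1,2)])
  from assms[OF this] show False
    using representation_basis[OF B(1,3)] by simp
qed

end

lemmas lin_ext_field =
  vector_space.lin_ext_add[OF vector_space_field]
  vector_space.lin_ext_diff[OF vector_space_field]
  vector_space.lin_ext_fscale[OF vector_space_field]
  vector_space.lin_ext_0[OF vector_space_field]
  vector_space.lin_ext_single[OF vector_space_field]
  vector_space.lin_ext_sum[OF vector_space_field]
  vector_space.lin_ext_lin_ext[OF vector_space_field]

lemma lin_ext_mult_left: "k * lin_ext (*) G p = lin_ext (*) (\<lambda>b. k * G b) p"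
  for k :: "'k::field"
  by (simp add: lin_ext_def sum_distrib_left mult.left_commute)

lemma lin_ext_mult_right: "lin_ext (*) G p * k = lin_ext (*) (\<lambda>b. G b * k) p"
  for k :: "'k::field"
  by (simp add: lin_ext_def sum_distrib_right mult.assoc)

text \<open>Tensors are formal sums of tuples, so a functional on a tensor power is well defined as soon
  as it kills the multilinearity relations.\<close>

lemma tensor2_eq_functional:
  assumes "tensor2_eq scale p p'"
    and "\<And>x x' y. B (x + x', y) = B (x, y) + B (x', y)"
    and "\<And>x y y'. B (x, y + y') = B (x, y) + B (x, y')"
    and "\<And>c x y. B (scale c x, y) = c * B (x, y)"
    and "\<And>c x y. B (x, scale c y) = c * B (x, y)"
  shows "lin_ext (*) B p = lin_ext (*) B p'"
proof -
  interpret k: vector_space "(*) :: 'a \<Rightarrow> 'a \<Rightarrow> 'a" by (rule vector_space_field)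
  interpret B: Vector_Spaces.linear fscale "(*)" "lin_ext (*) B" by (rule k.linear_lin_ext)
  have "\<forall>d\<in>tensor2_relations scale. lin_ext (*) B d = 0"
    unfolding tensor2_relations_def
    using assms(2-) by (auto simp: k.lin_ext_diff k.lin_ext_fscale)
  then have "lin_ext (*) B (p - p') = 0"
    using assms(1) B.eq_0_on_span unfolding tensor2_eq_def by blast
  then show ?thesis by (simp add: k.lin_ext_diff)
qed

lemma tensor3_eq_functional:
  assumes "tensor3_eq scale p p'"
    and "\<And>x x' y z. B (x + x', y, z) = B (x, y, z) + B (x', y, z)"
    and "\<And>x y y' z. B (x, y + y', z) = B (x, y, z) + B (x, y', z)"
    and "\<And>x y z z'. B (x, y, z + z') = B (x, y, z) + B (x, y, z')"
    and "\<And>c x y z. B (scale c x, y, z) = c * B (x, y, z)"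
    and "\<And>c x y z. B (x, scale c y, z) = c * B (x, y, z)"
    and "\<And>c x y z. B (x, y, scale c z) = c * B (x, y, z)"
  shows "lin_ext (*) B p = lin_ext (*) B p'"
proof -
  interpret k: vector_space "(*) :: 'a \<Rightarrow> 'a \<Rightarrow> 'a" by (rule vector_space_field)
  interpret B: Vector_Spaces.linear fscale "(*)" "lin_ext (*) B" by (rule k.linear_lin_ext)
  have "\<forall>d\<in>tensor3_relations scale. lin_ext (*) B d = 0"
    unfolding tensor3_relations_def
    using assms(2-) by (auto simp: k.lin_ext_diff k.lin_ext_fscale)
  then have "lin_ext (*) B (p - p') = 0"
    using assms(1) B.eq_0_on_span unfolding tensor3_eq_def by blast
  then show ?thesis by (simp add: k.lin_ext_diff)
qed

text \<open>The product of the dual algebra of a coalgebra.\<close>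

definition convolution ::
    "('a \<Rightarrow> ('a \<times> 'a \<Rightarrow>\<^sub>0 'k::field)) \<Rightarrow> ('a \<Rightarrow> 'k) \<Rightarrow> ('a \<Rightarrow> 'k) \<Rightarrow> 'a \<Rightarrow> 'k" where
  "convolution \<Delta> f g c = lin_ext (*) (\<lambda>(x, y). f x * g y) (\<Delta> c)"

lemma convolution_eq_if_tensor2_eq:
  assumes "k_algebra scale" and "linear_functional scale f" and "linear_functional scale g"
    and "tensor2_eq scale p p'"
  shows "lin_ext (*) (\<lambda>(x, y). f x * g y) p = lin_ext (*) (\<lambda>(x, y). f x * g y) p'"
  using assms(4) by (rule tensor2_eq_functional)
    (use assms(2,3) in \<open>auto simp: k_algebra.linear_functional_iff[OF assms(1)] algebra_simps\<close>)

locale k_coalgebra = k_algebra scale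
  for scale :: "'k::field \<Rightarrow> 'a::ring_1 \<Rightarrow> 'a" +
  fixes \<Delta> :: "'a \<Rightarrow> ('a \<times> 'a \<Rightarrow>\<^sub>0 'k)" and \<epsilon> :: "'a \<Rightarrow> 'k"
  assumes coalgebra: "coalgebra scale \<Delta> \<epsilon>"
begin

abbreviation functional :: "('a \<Rightarrow> 'k) \<Rightarrow> bool" where
  "functional f \<equiv> linear_functional scale f"

abbreviation conv (infixl \<open>\<star>\<close> 70) where
  "f \<star> g \<equiv> convolution \<Delta> f g"

lemma linear_counit: "functional \<epsilon>"
  using coalgebra by (simp add: coalgebra_def)

lemma linear_convolution:
  assumes "functional f" and "functional g"
  shows "functional (f \<star> g)"
proof -
  note eq = convolution_eq_if_tensor2_eq[OF k_algebra_axioms assms]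
  have "tensor2_eq scale (\<Delta> (c + d)) (\<Delta> c + \<Delta> d)"
    "tensor2_eq scale (\<Delta> (scale k c)) (fscale k (\<Delta> c))" for c d k
    using coalgebra by (simp_all add: coalgebra_def)
  from this[THEN eq] show ?thesis
    by (simp add: linear_functional_iff convolution_def lin_ext_field)
qed

lemma counit_convolution:
  assumes "functional f"
  shows "\<epsilon> \<star> f = f" and "f \<star> \<epsilon> = f"
proof -
  have c: "lin_ext scale (\<lambda>(x, y). scale (\<epsilon> x) y) (\<Delta> c) = c"
    "lin_ext scale (\<lambda>(x, y). scale (\<epsilon> y) x) (\<Delta> c) = c" for c
    using coalgebra by (simp_all add: coalgebra_def)
  have "f c = (\<epsilon> \<star> f) c" "f c = (f \<star> \<epsilon>) c" for c
    using linear_functional_lin_ext[OF assms, of "\<lambda>(x, y). scale (\<epsilon> x) y" "\<Delta> c"]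
      linear_functional_lin_ext[OF assms, of "\<lambda>(x, y). scale (\<epsilon> y) x" "\<Delta> c"] assms
    by (simp_all add: c[unfolded case_prod_unfold] convolution_def linear_functional_iff
        case_prod_unfold mult.commute)
  then show "\<epsilon> \<star> f = f" "f \<star> \<epsilon> = f"
    by auto
qed

lemma convolution_assoc:
  assumes "functional f" and "functional g" and "functional h"
  shows "f \<star> g \<star> h = f \<star> (g \<star> h)"
proof
  fix c
  note lin = assms[unfolded linear_functional_iff, THEN conjunct1, rule_format]
    assms[unfolded linear_functional_iff, THEN conjunct2, rule_format]
  define B where "B = (\<lambda>(x, y, z). f x * g y * h z)"
  have "tensor3_eq scale
      (lin_ext fscale (\<lambda>(x, y). lin_ext fscale (\<lambda>(x1, x2). pure (x1, x2, y)) (\<Delta> x)) (\<Delta> c))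
      (lin_ext fscale (\<lambda>(x, y). lin_ext fscale (\<lambda>(y1, y2). pure (x, y1, y2)) (\<Delta> y)) (\<Delta> c))"
    using coalgebra unfolding coalgebra_def by blast
  then have "lin_ext (*) B
      (lin_ext fscale (\<lambda>(x, y). lin_ext fscale (\<lambda>(x1, x2). pure (x1, x2, y)) (\<Delta> x)) (\<Delta> c)) =
    lin_ext (*) B
      (lin_ext fscale (\<lambda>(x, y). lin_ext fscale (\<lambda>(y1, y2). pure (x, y1, y2)) (\<Delta> y)) (\<Delta> c))"
    by (rule tensor3_eq_functional) (simp_all add: B_def lin algebra_simps)
  then have "lin_ext (*) (\<lambda>p. lin_ext (*) (\<lambda>r. f (fst r) * g (snd r) * h (snd p)) (\<Delta> (fst p))) (\<Delta> c) =
      lin_ext (*) (\<lambda>p. lin_ext (*) (\<lambda>r. f (fst p) * g (fst r) * h (snd r)) (\<Delta> (snd p))) (\<Delta> c)"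
    by (simp add: lin_ext_field B_def case_prod_unfold)
  moreover have "(f \<star> g \<star> h) c =
      lin_ext (*) (\<lambda>p. lin_ext (*) (\<lambda>r. f (fst r) * g (snd r) * h (snd p)) (\<Delta> (fst p))) (\<Delta> c)"
    unfolding convolution_def case_prod_unfold lin_ext_mult_right ..
  moreover have "(f \<star> (g \<star> h)) c =
      lin_ext (*) (\<lambda>p. lin_ext (*) (\<lambda>r. f (fst p) * g (fst r) * h (snd r)) (\<Delta> (snd p))) (\<Delta> c)"
    unfolding convolution_def case_prod_unfold lin_ext_mult_left mult.assoc ..
  ultimately show "(f \<star> g \<star> h) c = (f \<star> (g \<star> h)) c"
    by simp
qed

end

section \<open>Bi-Frobenius algebras\<close>

locale bi_frobenius_algebra =
  fixes scale :: "'k::field \<Rightarrow> 'a::ring_1 \<Rightarrow> 'a"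
    and \<Delta> :: "'a \<Rightarrow> ('a \<times> 'a \<Rightarrow>\<^sub>0 'k)"
    and \<epsilon> \<phi> :: "'a \<Rightarrow> 'k"
    and t :: 'a
    and S :: "'a \<Rightarrow> 'a"
  assumes bi_frobenius: "bi_frobenius scale \<Delta> \<epsilon> \<phi> t S"

sublocale bi_frobenius_algebra \<subseteq> k_coalgebra scale \<Delta> \<epsilon>
  using bi_frobenius by (auto simp: bi_frobenius_def k_coalgebra_def k_coalgebra_axioms_def)

context bi_frobenius_algebra
begin

lemma counit_one: "\<epsilon> 1 = 1"
  and counit_mult: "\<epsilon> (x * y) = \<epsilon> x * \<epsilon> y"
  and antipode_one: "S 1 = 1"
  and antipode_mult: "S (x * y) = S y * S x"
  and counit_antipode: "\<epsilon> (S x) = \<epsilon> x"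
  using bi_frobenius by (auto simp: bi_frobenius_def)

lemma linear_form: "functional \<phi>"
  using bi_frobenius by (auto simp: bi_frobenius_def frobenius_form_def)

lemma functional_form_mult: "functional f \<Longrightarrow> \<exists>b. f = \<phi> \<leftharpoonup>\<^sub>d b"
  using bi_frobenius by (auto simp: bi_frobenius_def frobenius_form_def)

lemma functional_mult_right: "functional f \<Longrightarrow> functional (\<lambda>x. f (x * b))"
  and functional_mult_left: "functional f \<Longrightarrow> functional (\<lambda>x. f (b * x))"
  by (simp_all add: linear_functional_iff distrib_left distrib_right scale_mult_left scale_mult_right)

lemma functional_add_eq: "functional f \<Longrightarrow> f (x + y) = f x + f y"
  and functional_diff_eq: "functional f \<Longrightarrow> f (x - y) = f x - f y"
  and functional_scale_eq: "functional f \<Longrightarrow> f (scale c x) = c * f x"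
  and functional_0_eq: "functional f \<Longrightarrow> f 0 = 0"
proof -
  assume f: "functional f"
  then show add: "f (x + y) = f x + f y" for x y
    by (simp add: linear_functional_iff)
  show "f (x - y) = f x - f y"
    using add[of "x - y" y] by simp
  show "f (scale c x) = c * f x"
    using f by (simp add: linear_functional_iff)
  show "f 0 = 0"
    using add[of 0 0] by (metis add.right_neutral add_left_cancel)
qed

lemma functional_eqI:
  assumes "\<And>f. functional f \<Longrightarrow> f x = f y"
  shows "x = y"
proof -
  have "x - y = 0"
    by (rule functionals_separate_points) (simp add: assms functional_diff_eq)
  then show ?thesis by simp
qed

text \<open>Testing the definition of \<open>S\<close> against functionals turns its Sweedler sum into a product in the
  dual algebra. All computations with \<open>S\<close> go through this form.\<close>

lemma functional_antipode:
  assumes "functional f"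
  shows "f (S b) = ((b \<rightharpoonup>\<^sub>d \<phi>) \<star> f) t"
proof -
  have "S b = lin_ext scale (\<lambda>(t1, t2). scale (\<phi> (t1 * b)) t2) (\<Delta> t)"
    using bi_frobenius by (auto simp: bi_frobenius_def)
  then show ?thesis
    using assms
    by (simp add: linear_functional_lin_ext convolution_def dual_lact_def case_prod_unfold
        functional_scale_eq)
qed

lemma functional_lact: "functional f \<Longrightarrow> functional (b \<rightharpoonup>\<^sub>d f)"
  unfolding dual_lact_def by (rule functional_mult_right)

lemma linear_antipode: "S (x + y) = S x + S y" "S (scale c x) = scale c (S x)"
proof -
  have S: "S = (\<lambda>b. lin_ext scale (\<lambda>(t1, t2). scale (\<phi> (t1 * b)) t2) (\<Delta> t))"
    using bi_frobenius by (simp add: bi_frobenius_def)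
  show "S (x + y) = S x + S y" "S (scale c x) = scale c (S x)"
    unfolding S lin_ext_def
    by (simp_all add: case_prod_unfold distrib_left functional_add_eq[OF linear_form] scale_mult_right
        functional_scale_eq[OF linear_form] scale_left_distrib scale_right_distrib
        sum.distrib scale_sum_right mult.left_commute)
qed

lemma functional_comp_antipode: "functional f \<Longrightarrow> functional (\<lambda>x. f (S x))"
  by (simp add: linear_functional_iff linear_antipode)

lemma convolution_antipode:
  assumes "functional f" and "functional g"
  shows "(f \<star> g) (S c) = ((\<lambda>x. g (S x)) \<star> (\<lambda>x. f (S x))) c"
proof -
  have "tensor2_eq scale (\<Delta> (S c)) (lin_ext fscale (\<lambda>(c1, c2). pure (S c2, S c1)) (\<Delta> c))"
    using bi_frobenius unfolding bi_frobenius_def by blast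
  from convolution_eq_if_tensor2_eq[OF k_algebra_axioms assms this] show ?thesis
    by (simp add: convolution_def lin_ext_field case_prod_unfold mult.commute)
qed

lemma convolution_one:
  assumes "functional f" and "functional g"
  shows "(f \<star> g) 1 = f 1 * g 1"
proof -
  have "tensor2_eq scale (\<Delta> 1) (pure (1, 1))"
    using bi_frobenius unfolding bi_frobenius_def by blast
  from convolution_eq_if_tensor2_eq[OF k_algebra_axioms assms this] show ?thesis
    by (simp add: convolution_def lin_ext_field)
qed

text \<open>The bilinear form \<open>(f, g) \<mapsto> (f \<star> g) t\<close> on the dual space is nondegenerate, because \<open>t\<close>
  generates the coalgebra.\<close>

lemma convolution_t_nondegenerate:
  assumes "functional g" and "functional h"
    and eq: "\<And>f. functional f \<Longrightarrow> (f \<star> g) t = (f \<star> h) t"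
  shows "g = h"
proof
  fix y
  have "frobenius_coalgebra scale \<Delta> t"
    using bi_frobenius by (simp add: bi_frobenius_def)
  then have "y \<in> {coalg_ract scale \<Delta> t f | f. functional f}"
    unfolding frobenius_coalgebra_def by blast
  then obtain f where f: "functional f" "y = coalg_ract scale \<Delta> t f"
    by auto
  have "g y = (f \<star> g) t" if "functional g" for g
    using that by (simp add: f(2) coalg_ract_def linear_functional_lin_ext convolution_def
        case_prod_unfold functional_scale_eq)
  from this[OF assms(1)] this[OF assms(2)] show "g y = h y"
    using eq[OF f(1)] by simp
qed

lemma form_nondegenerate:
  assumes "\<And>x. \<phi> (x * b) = \<phi> (x * c)"
  shows "b = c"
  using functional_form_mult assms by (intro functional_eqI) (force simp: dual_ract_def)

text \<open>The map \<open>b \<mapsto> b \<rightharpoonup> \<phi>\<close> is injective, hence by a dimension count onto the dual space. To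
  count dimensions inside the algebra, a functional is encoded by the element whose coordinates
  are its values on a basis.\<close>

lemma functional_lact_form:
  assumes "functional f"
  obtains b where "f = b \<rightharpoonup>\<^sub>d \<phi>"
proof -
  obtain B where "finite_dimensional_vector_space scale B"
    using bi_frobenius by (auto simp: bi_frobenius_def)
  then interpret fd: finite_dimensional_vector_space scale B .
  note B = fd.finite_Basis fd.independent_Basis fd.span_Basis
  have coords: "(\<forall>e\<in>B. c e = d e)"
    if "(\<Sum>e\<in>B. scale (c e) e) = (\<Sum>e\<in>B. scale (d e) e)" for c d
  proof -
    have "(\<Sum>e\<in>B. scale (c e - d e) e) = 0"
      using that by (simp add: scale_left_diff_distrib sum_subtractf)
    then show ?thesis
      using independentD[OF B(2) B(1) subset_refl] by fastforce
  qed
  have eqI: "g = h" if "functional g" "functional h" "\<forall>e\<in>B. g e = h e" for g h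
  proof
    fix y
    have "y \<in> span B" by (simp add: B(3))
    then show "g y = h y"
      by (induction rule: span_induct_alt)
        (use that in \<open>auto simp: functional_0_eq functional_add_eq functional_scale_eq\<close>)
  qed
  define \<theta> where "\<theta> = (\<lambda>b. \<Sum>e\<in>B. scale (\<phi> (e * b)) e)"
  have lin: "Vector_Spaces.linear scale scale \<theta>"
    by unfold_locales
      (simp_all add: \<theta>_def distrib_left scale_mult_right functional_add_eq[OF linear_form]
        functional_scale_eq[OF linear_form] scale_left_distrib sum.distrib scale_sum_right)
  have "inj \<theta>"
  proof (rule injI)
    fix b c assume "\<theta> b = \<theta> c"
    then have "\<forall>e\<in>B. \<phi> (e * b) = \<phi> (e * c)"
      unfolding \<theta>_def by (rule coords)
    then have "b \<rightharpoonup>\<^sub>d \<phi> = c \<rightharpoonup>\<^sub>d \<phi>"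
      by (intro eqI functional_lact linear_form) (simp add: dual_lact_def)
    then show "b = c"
      by (intro form_nondegenerate) (metis dual_lact_def)
  qed
  then have "surj \<theta>"
    by (rule fd.linear_inj_imp_surj[OF lin])
  then obtain b where "(\<Sum>e\<in>B. scale (f e) e) = \<theta> b"
    by blast
  then have "\<forall>e\<in>B. f e = \<phi> (e * b)"
    unfolding \<theta>_def by (rule coords)
  then have "f = b \<rightharpoonup>\<^sub>d \<phi>"
    by (intro eqI functional_lact linear_form assms) (simp add: dual_lact_def)
  then show thesis by (rule that)
qed

lemma form_nondegenerate_right:
  assumes "\<And>x. \<phi> (b * x) = \<phi> (c * x)"
  shows "b = c"
proof (rule functional_eqI)
  fix f assume "functional f"
  then obtain x where "f = x \<rightharpoonup>\<^sub>d \<phi>" by (rule functional_lact_form)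
  then show "f b = f c" by (simp add: dual_lact_def assms)
qed


lemma bij_antipode: "bij S"
proof -
  \<comment> \<open>The coalgebra generator turns functionals into elements, the form turns elements into
    functionals, and the antipode is the composite.\<close>
  have "\<exists>b. S b = y" for y
  proof -
    have "frobenius_coalgebra scale \<Delta> t"
      using bi_frobenius by (simp add: bi_frobenius_def)
    then have "y \<in> {coalg_ract scale \<Delta> t f | f. functional f}"
      unfolding frobenius_coalgebra_def by blast
    then obtain f where f: "functional f" "y = coalg_ract scale \<Delta> t f"
      by auto
    obtain b where "f = b \<rightharpoonup>\<^sub>d \<phi>"
      using functional_lact_form[OF f(1)] .
    then have "S b = y"
      using bi_frobenius f(2) by (simp add: bi_frobenius_def coalg_ract_def dual_lact_def)
    then show ?thesis ..
  qed
  then have "surj S" by (metis surj_def)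
  obtain B where "finite_dimensional_vector_space scale B"
    using bi_frobenius by (auto simp: bi_frobenius_def)
  then interpret fd: finite_dimensional_vector_space scale B .
  have "Vector_Spaces.linear scale scale S"
    by unfold_locales (simp_all add: linear_antipode)
  then show ?thesis
    using fd.linear_surj_imp_inj \<open>surj S\<close> by (simp add: bij_def)
qed

abbreviation S_inv :: "'a \<Rightarrow> 'a" where
  "S_inv \<equiv> inv S"

lemma antipode_S_inv [simp]: "S (S_inv x) = x" and S_inv_antipode [simp]: "S_inv (S x) = x"
  using bij_antipode by (simp_all add: bij_def surj_f_inv_f)

lemma S_inv_mult: "S_inv (x * y) = S_inv y * S_inv x"
  using antipode_mult[of "S_inv y" "S_inv x"] by (metis antipode_S_inv S_inv_antipode)

lemma S_inv_one: "S_inv 1 = 1"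
  using S_inv_antipode[of 1] by (simp add: antipode_one)

lemma linear_S_inv: "S_inv (x + y) = S_inv x + S_inv y" "S_inv (scale c x) = scale c (S_inv x)"
  by (metis linear_antipode antipode_S_inv S_inv_antipode)+

lemma functional_comp_S_inv: "functional f \<Longrightarrow> functional (\<lambda>x. f (S_inv x))"
  by (simp add: linear_functional_iff linear_S_inv)

lemma counit_S_inv: "\<epsilon> (S_inv x) = \<epsilon> x"
  using counit_antipode[of "S_inv x"] by simp

lemma antipode_power_4_iff: "S ^^ 4 = id \<longleftrightarrow> (\<forall>x. S (S x) = S_inv (S_inv x))"
proof -
  have "(S ^^ 4) x = x \<longleftrightarrow> S (S x) = S_inv (S_inv x)" for x
  proof -
    have "(S ^^ 4) x = S (S (S (S x)))"
      by (simp add: eval_nat_numeral)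
    then show ?thesis by (metis antipode_S_inv S_inv_antipode)
  qed
  then show ?thesis by (simp add: fun_eq_iff)
qed

lemma convolution_t_nondegenerate_left:
  assumes "functional g" and "functional h"
    and eq: "\<And>f. functional f \<Longrightarrow> (g \<star> f) t = (h \<star> f) t"
  shows "g = h"
proof -
  obtain c d where "g = c \<rightharpoonup>\<^sub>d \<phi>" "h = d \<rightharpoonup>\<^sub>d \<phi>"
    using functional_lact_form assms(1,2) by metis
  note gh = this
  have "f (S c) = f (S d)" if "functional f" for f
    using eq[OF that] by (simp add: functional_antipode[OF that] gh)
  then have "S c = S d"
    by (rule functional_eqI)
  then have "c = d"
    by (metis S_inv_antipode)
  then show ?thesis by (simp add: gh)
qed

text \<open>By definition \<open>\<Sum> \<phi> (t\<^sub>1 c) S\<^sup>-\<^sup>1 t\<^sub>2 = c\<close>, that is, \<open>t\<^sub>1\<close> and \<open>S\<^sup>-\<^sup>1 t\<^sub>2\<close> are dual bases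
  for \<open>\<phi>\<close>. The lemma is the resulting expansion \<open>b = \<Sum> t\<^sub>1 \<phi> (b S\<^sup>-\<^sup>1 t\<^sub>2)\<close>.\<close>

lemma dual_bases:
  assumes "functional f"
  shows "(f \<star> (\<lambda>x. \<phi> (b * S_inv x))) t = f b"
proof -
  obtain c where f: "f = c \<rightharpoonup>\<^sub>d \<phi>"
    using functional_lact_form[OF assms] .
  have "functional (\<lambda>x. \<phi> (b * S_inv x))"
    by (intro functional_comp_S_inv functional_mult_left linear_form)
  from functional_antipode[OF this, of c] show ?thesis
    by (simp add: f dual_lact_def)
qed

text \<open>That \<open>\<epsilon> \<circ> S = \<epsilon>\<close> says, after unfolding the antipode, that \<open>\<phi> (t x) = \<epsilon> x\<close>.\<close>

lemma form_t_mult: "\<phi> (t * x) = \<epsilon> x"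
proof -
  have "\<epsilon> x = (x \<rightharpoonup>\<^sub>d \<phi>) t"
    using functional_antipode[OF linear_counit, of x]
    by (simp add: counit_antipode counit_convolution(2)[OF functional_lact[OF linear_form]])
  then show ?thesis by (simp add: dual_lact_def)
qed

lemma form_t: "\<phi> t = 1"
  using form_t_mult[of 1] by (simp add: counit_one)

text \<open>A right integral \<open>s\<close> satisfies \<open>\<phi> (s x) = \<epsilon> x \<phi> s\<close>, and \<open>\<phi>\<close> determines \<open>s\<close> from these values.\<close>

lemma right_integral_iff: "(\<forall>x. s * x = scale (\<epsilon> x) s) \<longleftrightarrow> s = scale (\<phi> s) t"
proof -
  have t: "t * x = scale (\<epsilon> x) t" for x
    by (rule form_nondegenerate_right)
      (simp add: mult.assoc form_t_mult counit_mult scale_mult_left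
        functional_scale_eq[OF linear_form])
  have "s = scale (\<phi> s) t" if "\<forall>x. s * x = scale (\<epsilon> x) s"
    by (rule form_nondegenerate_right)
      (simp add: that scale_mult_left form_t_mult functional_scale_eq[OF linear_form])
  moreover have "s * x = scale (\<epsilon> x) s" if "s = scale (\<phi> s) t" for x
    by (subst (1 2) that) (simp add: scale_mult_left t mult.commute)
  ultimately show ?thesis by blast
qed

abbreviation \<aa> :: 'a where
  "\<aa> \<equiv> modular_element scale \<Delta> \<phi> t"

lemma functional_modular_element: "functional f \<Longrightarrow> f \<aa> = (f \<star> \<phi>) t"
  by (simp add: modular_element_def coalg_lact_def linear_functional_lin_ext convolution_def
      case_prod_unfold functional_scale_eq mult.commute)

text \<open>Both sides are \<open>\<Sum> \<phi> (t\<^sub>1 b) \<phi> (t\<^sub>2)\<close>.\<close>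

lemma form_antipode: "\<phi> (S b) = \<phi> (\<aa> * b)"
  using functional_antipode[OF linear_form, of b]
    functional_modular_element[OF functional_lact[OF linear_form], of b]
  by (simp add: dual_lact_def)

lemma counit_modular_element: "\<epsilon> \<aa> = 1"
  using functional_modular_element[OF linear_counit] counit_convolution(1)[OF linear_form] form_t
  by simp

end

text \<open>For a two-sided integral \<open>t\<close> the modular function is trivial, and Radford's formula for \<open>S\<^sup>4\<close>
  involves the modular element only.\<close>

locale unimodular_bi_frobenius_algebra = bi_frobenius_algebra scale \<Delta> \<epsilon> \<phi> t S
  for scale :: "'k::field \<Rightarrow> 'a::ring_1 \<Rightarrow> 'a" and \<Delta> \<epsilon> \<phi> t S +
  assumes left_integral_t: "x * t = scale (\<epsilon> x) t"
begin

lemma form_mult_t: "\<phi> (x * t) = \<epsilon> x"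
  by (simp add: left_integral_t functional_scale_eq[OF linear_form] form_t)

text \<open>Compute \<open>f (S b)\<close> in two ways: by the definition of the antipode, and by applying \<open>S\<close> to
  the dual basis expansion of \<open>b\<close>, using that \<open>S\<close> reverses \<open>\<Delta> t\<close> up to a scalar because
  integrals are unique. Comparing shows that \<open>S\<^sup>-\<^sup>2\<close> is the Nakayama automorphism.\<close>

lemma form_nakayama: "\<phi> (x * y) = \<phi> (y * S_inv (S_inv x))"
proof -
  define k where "k = \<phi> (S t)"
  have "S t * x = scale (\<epsilon> x) (S t)" for x
    using antipode_mult[of "S_inv x" t]
    by (simp add: left_integral_t linear_antipode counit_S_inv)
  then have St: "S t = scale k t"
    using right_integral_iff k_def by blast
  have key: "\<phi> (x * b) = k * \<phi> (b * S_inv (S_inv x))" for x b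
  proof -
    let ?g = "\<lambda>x. \<phi> (b * S_inv (S_inv x))"
    have g: "functional ?g"
      by (intro functional_comp_S_inv functional_mult_left linear_form)
    have "((b \<rightharpoonup>\<^sub>d \<phi>) \<star> f) t = ((\<lambda>x. k * ?g x) \<star> f) t" if f: "functional f" for f
    proof -
      have "((b \<rightharpoonup>\<^sub>d \<phi>) \<star> f) t = f (S b)"
        by (simp add: functional_antipode[OF f])
      also have "\<dots> = ((\<lambda>x. f (S x)) \<star> (\<lambda>x. ?g (S x))) t"
        using dual_bases[OF functional_comp_antipode[OF f], of b] by simp
      also have "\<dots> = (?g \<star> f) (S t)"
        by (rule convolution_antipode[OF g f, symmetric])
      also have "\<dots> = k * (?g \<star> f) t"
        by (simp add: St functional_scale_eq[OF linear_convolution[OF g f]])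
      finally show ?thesis
        by (simp add: convolution_def lin_ext_mult_left case_prod_unfold mult.assoc)
    qed
    moreover have "functional (\<lambda>x. k * ?g x)"
      using g by (simp add: linear_functional_iff distrib_left mult.left_commute)
    ultimately have "b \<rightharpoonup>\<^sub>d \<phi> = (\<lambda>x. k * ?g x)"
      by (intro convolution_t_nondegenerate_left functional_lact linear_form)
    then show ?thesis by (simp add: dual_lact_def fun_eq_iff)
  qed
  \<comment> \<open>The form at \<open>1\<close> may vanish, but at \<open>t\<close> it is \<open>1\<close>.\<close>
  from key[of 1 t] have "k = 1"
    by (simp add: S_inv_one form_t)
  with key show ?thesis by simp
qed

lemma form_nakayama': "\<phi> (S (S x) * y) = \<phi> (y * x)"
  using form_nakayama[of "S (S x)" y] by simp

text \<open>The form \<open>\<phi> \<circ> S = \<phi> \<leftharpoonup> \<aa>\<close> has the Nakayama automorphism \<open>S\<^sup>2\<close>, the inverse of that of \<open>\<phi>\<close>,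
  because \<open>S\<close> reverses products. Passing from \<open>\<phi>\<close> to \<open>\<phi> \<leftharpoonup> \<aa>\<close>, on the other hand, conjugates the
  Nakayama automorphism by a unit. Hence \<open>S\<^sup>4\<close> is conjugation by \<open>\<aa>\<close>.\<close>

lemma antipode_square_modular: "S (S y) * \<aa> = \<aa> * S_inv (S_inv y)"
proof (rule form_nondegenerate_right)
  fix x
  have "\<phi> (S (S y) * \<aa> * x) = \<phi> (S (x * y))"
    by (simp add: mult.assoc form_nakayama' form_antipode)
  also have "\<dots> = \<phi> (S x * S (S_inv (S_inv y)))"
    by (simp add: antipode_mult form_nakayama[of "S y"])
  also have "\<dots> = \<phi> (\<aa> * S_inv (S_inv y) * x)"
    by (simp add: antipode_mult[symmetric] form_antipode mult.assoc del: antipode_S_inv)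
  finally show "\<phi> (S (S y) * \<aa> * x) = \<phi> (\<aa> * S_inv (S_inv y) * x)" .
qed

text \<open>Expand \<open>\<phi> \<circ> S\<^sup>2 = \<phi>\<close>, the invariance of \<open>\<phi>\<close> under its Nakayama automorphism, using
  \<open>\<phi> \<circ> S = \<phi> \<leftharpoonup> \<aa>\<close>.\<close>

lemma antipode_modular_mult: "S \<aa> * \<aa> = 1"
proof (rule form_nondegenerate_right)
  fix x
  have "\<phi> (S \<aa> * \<aa> * x) = \<phi> (\<aa> * x * S_inv \<aa>)"
    using form_nakayama[of "S \<aa>" "\<aa> * x"] by (simp add: mult.assoc)
  also have "\<dots> = \<phi> (\<aa> * S x)"
    using form_antipode[of "x * S_inv \<aa>"] by (simp add: antipode_mult mult.assoc)
  also have "\<dots> = \<phi> (1 * x)"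
    using form_antipode[of "S x"] form_nakayama'[of x 1] by simp
  finally show "\<phi> (S \<aa> * \<aa> * x) = \<phi> (1 * x)" .
qed

text \<open>This is the Nakayama automorphism of the dual algebra with the form \<open>f \<mapsto> f t\<close>. For
  \<open>f = c \<rightharpoonup> \<phi>\<close>, both sides equal \<open>g (\<aa> S\<^sup>-\<^sup>1 c)\<close>: the left one by the dual bases, the right one by the
  definition of the antipode.\<close>

lemma convolution_t_commute:
  assumes "functional f" and "functional g"
  shows "(g \<star> f) t = (f \<star> (\<lambda>x. g (\<aa> * S_inv (S_inv x)))) t"
proof -
  obtain c where f: "f = c \<rightharpoonup>\<^sub>d \<phi>"
    using functional_lact_form[OF assms(1)] .
  have "functional (\<lambda>x. g (\<aa> * S_inv (S_inv x)))"
    by (intro functional_comp_S_inv functional_mult_left assms)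
  from functional_antipode[OF this, of c]
  have "(f \<star> (\<lambda>x. g (\<aa> * S_inv (S_inv x)))) t = g (\<aa> * S_inv c)"
    by (simp add: f)
  moreover have "\<phi> (\<aa> * S_inv c * S_inv w) = f w" for w
    using form_antipode[of "S_inv c * S_inv w"] antipode_mult[of "S_inv c" "S_inv w"]
    by (simp add: mult.assoc f dual_lact_def)
  ultimately show ?thesis
    using dual_bases[OF assms(2), of "\<aa> * S_inv c"] by simp
qed

text \<open>Nakayama automorphisms are multiplicative. In the dual algebra this says that \<open>x \<mapsto> \<aa> S\<^sup>-\<^sup>2 x\<close> is
  comultiplicative.\<close>

lemma convolution_modular:
  assumes "functional f" and "functional g"
  shows "(f \<star> g) (\<aa> * S_inv (S_inv x)) =
    ((\<lambda>x. f (\<aa> * S_inv (S_inv x))) \<star> (\<lambda>x. g (\<aa> * S_inv (S_inv x)))) x"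
proof -
  define \<nu> where "\<nu> f = (\<lambda>x. f (\<aa> * S_inv (S_inv x)))" for f :: "'a \<Rightarrow> 'k"
  have \<nu>: "functional (\<nu> f)" if "functional f" for f
    unfolding \<nu>_def by (intro functional_comp_S_inv functional_mult_left that)
  have com: "(g \<star> f) t = (f \<star> \<nu> g) t" if "functional f" "functional g" for f g
    unfolding \<nu>_def using that by (rule convolution_t_commute)
  have "\<nu> (f \<star> g) = \<nu> f \<star> \<nu> g"
  proof (rule convolution_t_nondegenerate)
    fix h assume h: "functional h"
    note l = assms h \<nu> linear_convolution
    have "(h \<star> \<nu> (f \<star> g)) t = (f \<star> (g \<star> h)) t"
      by (simp add: com[symmetric] l convolution_assoc)
    also have "\<dots> = (g \<star> (h \<star> \<nu> f)) t"
      by (simp add: com[of "g \<star> h" f] l convolution_assoc)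
    also have "\<dots> = (h \<star> (\<nu> f \<star> \<nu> g)) t"
      by (simp add: com[of "h \<star> \<nu> f" g] l convolution_assoc)
    finally show "(h \<star> \<nu> (f \<star> g)) t = (h \<star> (\<nu> f \<star> \<nu> g)) t" .
  qed (intro \<nu> linear_convolution assms)+
  then show ?thesis by (simp add: \<nu>_def fun_eq_iff)
qed

text \<open>Although \<open>\<Delta>\<close> need not be multiplicative, all powers of \<open>\<aa>\<close> are group-like: they arise from
  \<open>1\<close> by iterating the coalgebra automorphism \<open>\<aa> S\<^sup>-\<^sup>2\<close>.\<close>

lemma modular_power_grouplike:
  assumes unit: "\<aa> \<in> unit_elements" and "functional f" and "functional g"
  shows "(f \<star> g) (\<aa> ^ m) = f (\<aa> ^ m) * g (\<aa> ^ m)"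
proof -
  obtain w where w: "\<aa> * w = 1" "w * \<aa> = 1"
    using unit by (auto simp: unit_elements_def)
  have "S \<aa> = w"
    using antipode_modular_mult w by (metis mult.assoc mult.left_neutral mult.right_neutral)
  then have "S w = \<aa>"
    using antipode_mult[of w \<aa>] w antipode_one
    by (metis mult.assoc mult.left_neutral mult.right_neutral)
  then have inv2: "S_inv (S_inv \<aa>) = \<aa>"
    using \<open>S \<aa> = w\<close> by (metis S_inv_antipode)
  then have pow: "S_inv (S_inv (\<aa> ^ m)) = \<aa> ^ m" for m
    by (induction m) (simp_all add: S_inv_one S_inv_mult)
  show ?thesis
    using assms(2,3)
  proof (induction m arbitrary: f g)
    case 0
    then show ?case by (simp add: convolution_one)
  next
    case (Suc m)
    have "functional (\<lambda>x. f (\<aa> * S_inv (S_inv x)))" if "functional f" for f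
      by (intro functional_comp_S_inv functional_mult_left that)
    from Suc.IH[OF this[OF Suc.prems(1)] this[OF Suc.prems(2)]]
    show ?case
      using convolution_modular[OF Suc.prems, of "\<aa> ^ m"] by (simp add: pow)
  qed
qed

end

section \<open>Group-like powers of a unipotent element in characteristic zero\<close>

text \<open>\<open>m \<mapsto> m choose k\<close> is a polynomial of degree \<open>k\<close>, namely the falling factorial divided by
  \<open>k!\<close>.\<close>

definition falling_poly :: "nat \<Rightarrow> 'k::field poly" where
  "falling_poly k = (\<Prod>j<k. [:- of_nat j, 1:])"

lemma degree_falling_poly: "degree (falling_poly k :: 'k::field poly) = k"
  and lead_coeff_falling_poly: "lead_coeff (falling_poly k :: 'k::field poly) = 1"
proof -
  have "lead_coeff (falling_poly k :: 'k poly) = 1 \<and> degree (falling_poly k :: 'k poly) = k"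
  proof (induction k)
    case (Suc k)
    then have "(falling_poly k :: 'k poly) \<noteq> 0" by auto
    have step: "(falling_poly (Suc k) :: 'k poly) = falling_poly k * [:- of_nat k, 1:]"
      by (simp only: falling_poly_def prod.lessThan_Suc)
    have "degree (falling_poly (Suc k) :: 'k poly) = Suc k"
      using Suc \<open>(falling_poly k :: 'k poly) \<noteq> 0\<close> unfolding step by (subst degree_mult_eq) auto
    moreover have "lead_coeff (falling_poly (Suc k) :: 'k poly) =
        lead_coeff (falling_poly k) * lead_coeff [:- of_nat k, 1 :: 'k:]"
      by (simp only: step lead_coeff_mult)
    ultimately show ?case
      using Suc by auto
  qed (simp add: falling_poly_def)
  then show "degree (falling_poly k :: 'k poly) = k" "lead_coeff (falling_poly k :: 'k poly) = 1"
    by auto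
qed

lemma poly_falling_poly: "poly (falling_poly k) (of_nat m) = (of_nat (fact k * (m choose k)) :: 'k::field)"
proof (induction k)
  case (Suc k)
  have "poly (falling_poly (Suc k)) (of_nat m :: 'k) =
      of_nat (fact k * (m choose k)) * (of_nat m - of_nat k)"
    using Suc by (simp add: falling_poly_def algebra_simps)
  also have "\<dots> = of_nat (fact k * ((m choose k) * (m - k)))"
    by (cases "k \<le> m") (simp_all add: of_nat_diff binomial_eq_0)
  also have "(m choose k) * (m - k) = Suc k * (m choose Suc k)"
    by (metis binomial_absorb_comp binomial_absorption mult.commute)
  finally show ?case by (simp add: algebra_simps)
qed (simp add: falling_poly_def)

lemma binomial_sum_poly:
  fixes c :: "nat \<Rightarrow> 'k::field"
  assumes "CHAR('k) = 0"
  obtains p where "degree p \<le> n" and "coeff p n = c n / of_nat (fact n)"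
    and "\<And>m. poly p (of_nat m) = (\<Sum>k\<le>n. of_nat (m choose k) * c k)"
proof
  let ?p = "\<Sum>k\<le>n. smult (c k / of_nat (fact k)) (falling_poly k)"
  have fact: "of_nat (fact k) \<noteq> (0 :: 'k)" for k
    by (simp add: of_nat_eq_0_iff_char_dvd assms del: of_nat_fact)
  show "degree ?p \<le> n"
    by (intro degree_sum_le) (auto simp: degree_falling_poly intro: order.trans[OF degree_smult_le])
  have "coeff (falling_poly k :: 'k poly) n = (if k = n then 1 else 0)" if "k \<le> n" for k
    using lead_coeff_falling_poly[of k] that
    by (auto simp: degree_falling_poly intro: coeff_eq_0)
  then show "coeff ?p n = c n / of_nat (fact n)"
    by (simp add: coeff_sum if_distrib[of "(*) _"] cong: if_cong)
  show "poly ?p (of_nat m) = (\<Sum>k\<le>n. of_nat (m choose k) * c k)" for m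
    using fact by (auto simp: poly_sum poly_falling_poly simp del: of_nat_fact intro!: sum.cong)
qed

lemma inj_of_nat_CHAR_0:
  assumes "CHAR('k::ring_1) = 0"
  shows "inj (of_nat :: nat \<Rightarrow> 'k)"
proof -
  have "m = n" if "of_nat m = (of_nat n :: 'k)" "m \<le> n" for m n
  proof -
    have "of_nat (n - m) = (0 :: 'k)"
      using that by (simp add: of_nat_diff)
    then have "n - m = 0"
      unfolding of_nat_eq_0_iff_char_dvd assms by simp
    then show ?thesis
      using that(2) by simp
  qed
  then show ?thesis
    by (metis injI nle_le)
qed

text \<open>The square of a polynomial of positive degree \<open>n\<close> has degree \<open>2 n > n\<close>.\<close>

lemma binomial_sum_square:
  fixes c d :: "nat \<Rightarrow> 'k::field"
  assumes "CHAR('k) = 0" and "n > 0"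
    and eq: "\<And>m. (\<Sum>k\<le>n. of_nat (m choose k) * c k)\<^sup>2 = (\<Sum>k\<le>n. of_nat (m choose k) * d k)"
  shows "c n = 0"
proof (rule ccontr)
  assume "c n \<noteq> 0"
  obtain p where p: "degree p \<le> n" "coeff p n = c n / of_nat (fact n)"
    "\<And>m. poly p (of_nat m) = (\<Sum>k\<le>n. of_nat (m choose k) * c k)"
    using binomial_sum_poly[OF assms(1)] by metis
  obtain r where r: "degree r \<le> n" "\<And>m. poly r (of_nat m) = (\<Sum>k\<le>n. of_nat (m choose k) * d k)"
    using binomial_sum_poly[OF assms(1), of n d] by metis
  have "inj (of_nat :: nat \<Rightarrow> 'k)"
    using assms(1) by (rule inj_of_nat_CHAR_0)
  then have "infinite (range (of_nat :: nat \<Rightarrow> 'k))"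
    by (rule range_inj_infinite)
  moreover have "range of_nat \<subseteq> {y. poly (p ^ 2 - r) y = 0}"
    using eq by (auto simp: p(3) r(2) poly_power)
  ultimately have "p ^ 2 - r = 0"
    using poly_roots_finite finite_subset by blast
  then have "degree (p ^ 2) \<le> n"
    using r(1) by simp
  moreover have "coeff p n \<noteq> 0"
    using p(2) \<open>c n \<noteq> 0\<close> by (simp add: of_nat_eq_0_iff_char_dvd assms(1) del: of_nat_fact)
  then have "degree p = n" "p \<noteq> 0"
    using p(1) le_degree[of p n] by auto
  then have "degree (p ^ 2) = 2 * n"
    by (simp add: degree_power_eq)
  ultimately show False
    using \<open>n > 0\<close> by simp
qed

context unimodular_bi_frobenius_algebra
begin

lemma functional_unipotent_power:
  assumes "functional f" and "y ^ Suc n = 0"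
  shows "f ((1 + y) ^ m) = (\<Sum>k\<le>n. of_nat (m choose k) * f (y ^ k))"
  using assms(1)
proof (induction m arbitrary: f)
  case 0
  have "(\<Sum>k\<le>n. of_nat (0 choose k) * f (y ^ k)) = (\<Sum>k\<in>{0}. of_nat (0 choose k) * f (y ^ k))"
    by (intro sum.mono_neutral_right) (auto simp: binomial_eq_0)
  then show ?case by simp
next
  case (Suc m)
  let ?s = "\<lambda>m f. \<Sum>k<Suc n. of_nat (m choose k) * f (y ^ k)"
  have split: "?s m f = f 1 + (\<Sum>k<n. of_nat (m choose Suc k) * f (y ^ Suc k))" for m
    by (subst sum.lessThan_Suc_shift) simp
  have "f (y * y ^ n) = 0"
    using assms(2) by (simp add: functional_0_eq[OF Suc.prems])
  then have shift: "?s m (\<lambda>z. f (y * z)) = (\<Sum>k<n. of_nat (m choose k) * f (y ^ Suc k))"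
    by simp
  have "f ((1 + y) ^ Suc m) = f ((1 + y) ^ m) + f (y * (1 + y) ^ m)"
    by (simp add: distrib_right functional_add_eq[OF Suc.prems])
  also have "\<dots> = ?s m f + ?s m (\<lambda>z. f (y * z))"
    using Suc.IH[OF Suc.prems] Suc.IH[OF functional_mult_left[OF Suc.prems]]
    by (simp only: lessThan_Suc_atMost)
  also have "\<dots> = ?s (Suc m) f"
    unfolding split shift by (simp add: sum.distrib[symmetric] distrib_right add.commute)
  finally show ?case
    by (simp only: lessThan_Suc_atMost)
qed

text \<open>The values of a functional at the group-like elements \<open>\<aa>\<^sup>m\<close> form a polynomial in \<open>m\<close> whose
  degree is bounded by the nilpotency of \<open>\<aa> - 1\<close>. Convolution multiplies these polynomials, so
  they must be constant.\<close>

lemma modular_element_eq_one: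
  assumes "CHAR('k) = 0" and "\<aa> \<in> unit_elements" and nilpotent: "(\<aa> - 1) ^ j = 0"
  shows "\<aa> = 1"
proof (rule ccontr)
  assume "\<aa> \<noteq> 1"
  define y where "y = \<aa> - 1"
  have aa: "\<aa> = 1 + y" and "y \<noteq> 0"
    using \<open>\<aa> \<noteq> 1\<close> by (simp_all add: y_def)
  define l where "l = (LEAST j. y ^ j = 0)"
  have l: "y ^ l = 0"
    unfolding l_def by (rule LeastI[of _ j]) (simp add: y_def nilpotent)
  have "l \<noteq> 0" "l \<noteq> 1"
    using l \<open>y \<noteq> 0\<close> by (metis power_0 zero_neq_one, metis power_one_right)
  then obtain n where n: "l = Suc n" "n > 0"
    by (cases l) auto
  have "y ^ n \<noteq> 0"
    using not_less_Least[of n "\<lambda>j. y ^ j = 0"] n(1) by (simp add: l_def)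
  then obtain f where f: "functional f" "f (y ^ n) \<noteq> 0"
    using functionals_separate_points by blast
  have pow: "g (\<aa> ^ m) = (\<Sum>k\<le>n. of_nat (m choose k) * g (y ^ k))" if "functional g" for g m
    unfolding aa using that l n(1) by (intro functional_unipotent_power) auto
  have "f (y ^ n) = 0"
  proof (rule binomial_sum_square[OF assms(1) n(2)])
    show "(\<Sum>k\<le>n. of_nat (m choose k) * f (y ^ k))\<^sup>2 =
        (\<Sum>k\<le>n. of_nat (m choose k) * (f \<star> f) (y ^ k))" for m
      using modular_power_grouplike[OF assms(2) f(1) f(1), of m]
      by (simp add: pow[symmetric] f(1) linear_convolution power2_eq_square)
  qed
  with f(2) show False by contradiction
qed

end

section \<open>The standard basis of a quantum complete intersection\<close>

lemma poly_mapping_sum_singles: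
  "p = (\<Sum>b\<in>Poly_Mapping.keys p. Poly_Mapping.single b (Poly_Mapping.lookup p b))"
  by (rule poly_mapping_eqI) (auto simp: lookup_sum lookup_single when_def in_keys_iff)

definition unit_exponent :: "'i \<Rightarrow> 'i \<Rightarrow> nat" where
  "unit_exponent i = (\<lambda>j. if j = i then 1 else 0)"

definition add_exponents :: "('i \<Rightarrow> nat) \<Rightarrow> ('i \<Rightarrow> nat) \<Rightarrow> 'i \<Rightarrow> nat" (infixl \<open>\<oplus>\<close> 65) where
  "u \<oplus> v = (\<lambda>i. u i + v i)"

lemma add_exponents_0 [simp]: "u \<oplus> (\<lambda>i. 0) = u" "(\<lambda>i. 0) \<oplus> u = u"
  by (simp_all add: add_exponents_def)

lemma add_exponents_commute: "u \<oplus> v = v \<oplus> u"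
  by (simp add: add_exponents_def add.commute)

lemma count_list_Cons_exponent: "count_list (i # w) = unit_exponent i \<oplus> count_list w"
  by (auto simp: unit_exponent_def add_exponents_def)

lemma count_list_append_exponent: "count_list (u @ w) = count_list u \<oplus> count_list w"
  by (auto simp: add_exponents_def)

lemma count_list_Nil_exponent: "count_list [] = (\<lambda>i. 0)"
  by auto

lemma ex_word_of_exponent: "\<exists>w. count_list w = v" for v :: "'i::finite \<Rightarrow> nat"
proof -
  have count: "count_list (concat (map (\<lambda>i. replicate (v i) i) L)) j = (if j \<in> set L then v j else 0)"
    if "distinct L" for L and j :: 'i
  proof -
    have rep: "count_list (replicate n i) j = (if i = j then n else 0)" for n and i :: 'i
      by (induction n) auto
    show ?thesis
      using that by (induction L) (auto simp: rep)
  qed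
  obtain L :: "'i list" where "distinct L" "set L = UNIV"
    using finite_distinct_list[OF finite[of UNIV]] by blast
  then show ?thesis
    using count by (intro exI[of _ "concat (map (\<lambda>i. replicate (v i) i) L)"]) auto
qed

locale quantum_complete_intersection_algebra =
  fixes scale :: "'k::field \<Rightarrow> 'a::ring_1 \<Rightarrow> 'a"
    and x :: "'i::{finite,linorder} \<Rightarrow> 'a"
    and q :: "'i \<Rightarrow> 'i \<Rightarrow> 'k"
    and a :: "'i \<Rightarrow> nat"
  assumes a_ge_2: "a i \<ge> 2"
    and q_diag: "q i i = 1"
    and q_inverse: "q i j * q j i = 1"
    and qci: "quantum_complete_intersection scale x q a"

sublocale quantum_complete_intersection_algebra \<subseteq> k_algebra scale
  using qci by (simp add: quantum_complete_intersection_def)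

context quantum_complete_intersection_algebra
begin

text \<open>The scalar in \<open>x\<^sub>u x\<^sub>v = \<chi> u v x\<^bsub>u+v\<^esub>\<close>.\<close>

definition \<chi> :: "('i \<Rightarrow> nat) \<Rightarrow> ('i \<Rightarrow> nat) \<Rightarrow> 'k" where
  "\<chi> u v = q_pairing q (\<lambda>i. int (u i)) (\<lambda>i. int (v i))"

lemma q_nonzero: "q i j \<noteq> 0"
  using q_inverse[of i j] by auto

lemma \<chi>_eq: "\<chi> u v = (\<Prod>(i, j)\<in>{(i, j). i < j}. q i j ^ (u j * v i))"
  unfolding \<chi>_def q_pairing_def
  by (simp only: of_nat_mult[symmetric] power_int_of_nat)

lemma \<chi>_nonzero: "\<chi> u v \<noteq> 0"
  by (auto simp: \<chi>_eq q_nonzero)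

lemma \<chi>_add_left: "\<chi> (u \<oplus> u') v = \<chi> u v * \<chi> u' v"
  and \<chi>_add_right: "\<chi> v (u \<oplus> u') = \<chi> v u * \<chi> v u'"
  by (simp_all add: \<chi>_eq add_exponents_def case_prod_unfold prod.distrib[symmetric] power_add
      distrib_left distrib_right)

lemma \<chi>_0 [simp]: "\<chi> u (\<lambda>i. 0) = 1" "\<chi> (\<lambda>i. 0) u = 1"
  by (simp_all add: \<chi>_eq)

lemma \<chi>_unit_left: "\<chi> (unit_exponent i) v = (\<Prod>j | j < i. q j i ^ v j)"
proof -
  have "\<chi> (unit_exponent i) v =
      (\<Prod>(k, j)\<in>(\<lambda>k. (k, i)) ` {k. k < i}. q k j ^ (unit_exponent i j * v k))"
    unfolding \<chi>_eq
    by (intro prod.mono_neutral_right) (auto simp: unit_exponent_def)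
  also have "\<dots> = (\<Prod>j | j < i. q j i ^ v j)"
    by (subst prod.reindex) (auto simp: inj_on_def unit_exponent_def)
  finally show ?thesis .
qed

lemma \<chi>_unit_unit: "\<chi> (unit_exponent i) (unit_exponent j) = (if j < i then q j i else 1)"
proof -
  have "q k i ^ unit_exponent j k = (if k = j then q k i else 1)" for k
    by (simp add: unit_exponent_def)
  then show ?thesis
    by (simp add: \<chi>_unit_left prod.delta')
qed

text \<open>The scalar by which reordering changes a word into a standard monomial.\<close>

primrec word_coeff :: "'i list \<Rightarrow> 'k" where
  "word_coeff [] = 1"
| "word_coeff (i # w) = \<chi> (unit_exponent i) (count_list w) * word_coeff w"

lemma word_coeff_append:
  "word_coeff (u @ w) = word_coeff u * word_coeff w * \<chi> (count_list u) (count_list w)"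
proof (induction u)
  case Nil
  then show ?case by (simp add: count_list_Nil_exponent)
next
  case (Cons i u)
  show ?case
    by (simp add: Cons count_list_Cons_exponent count_list_append_exponent \<chi>_add_left \<chi>_add_right
        mult_ac del: count_list.simps)
qed

lemma word_coeff_nonzero: "word_coeff w \<noteq> 0"
  by (induction w) (simp_all add: \<chi>_nonzero)

lemma free_eval_single:
  "free_eval scale x (Poly_Mapping.single (Word w) c) = scale c (prod_list (map x w))"
  by (simp add: free_eval_def)

lemma gen_power: "gen i ^ n = (Poly_Mapping.single (Word (replicate n i)) 1 :: ('k, 'i) free_algebra)"
  by (induction n) (simp_all add: gen_def mult_single plus_fmon_def zero_fmon_def flip: single_one)

lemma gen_mult: "gen i * gen j = (Poly_Mapping.single (Word [i, j]) 1 :: ('k, 'i) free_algebra)"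
  by (simp add: gen_def mult_single plus_fmon_def)

lemma free_eval_relation: "p \<in> qci_relations q a \<Longrightarrow> free_eval scale x p = 0"
proof -
  assume "p \<in> qci_relations q a"
  then have "p \<in> two_sided_ideal hull (qci_relations q a)"
    by (rule hull_inc)
  then show ?thesis
    using qci by (auto simp: quantum_complete_intersection_def)
qed

lemma x_nilpotent: "x i ^ a i = 0"
proof -
  have "free_eval scale x (gen i ^ a i) = 0"
    by (rule free_eval_relation) (auto simp: qci_relations_def)
  moreover have "prod_list (map x (replicate n i)) = x i ^ n" for n
    by (induction n) auto
  ultimately show ?thesis by (simp add: gen_power free_eval_single)
qed

lemma x_commute: "x j * x i = scale (q i j) (x i * x j)"
proof -
  have "free_eval scale x (gen j * gen i - fscale (q i j) (gen i * gen j)) = 0"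
    by (rule free_eval_relation) (auto simp: qci_relations_def)
  then show ?thesis
    by (simp add: free_eval_def gen_mult lin_ext_diff lin_ext_fscale)
qed

lemma x_commute_power: "x i * x j ^ m = scale (q j i ^ m) (x j ^ m * x i)"
proof (induction m)
  case (Suc m)
  have "x i * x j ^ Suc m = scale (q j i) (x j * (x i * x j ^ m))"
    by (simp add: mult.assoc[symmetric] x_commute[of i j] scale_mult_left)
  then show ?case
    by (simp add: Suc scale_mult_right mult.assoc)
qed simp

text \<open>Moving \<open>x i\<close> to its place in the sorted product, it passes exactly the powers of the smaller
  generators.\<close>

lemma x_mult_std_monomial:
  "x i * std_monomial x v = scale (\<chi> (unit_exponent i) v) (std_monomial x (unit_exponent i \<oplus> v))"
proof -
  let ?m = "\<lambda>v L. prod_list (map (\<lambda>j. x j ^ v j) L)"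
  have "x i * ?m v L = scale (\<Prod>j\<in>{j\<in>set L. j < i}. q j i ^ v j) (?m (unit_exponent i \<oplus> v) L)"
    if "sorted L" "distinct L" "i \<in> set L" for L
    using that
  proof (induction L)
    case (Cons k L)
    show ?case
    proof (cases "k = i")
      case True
      have no_less: "{j \<in> set (k # L). j < i} = {}"
        using Cons.prems True by auto
      moreover have "?m (unit_exponent i \<oplus> v) L = ?m v L"
        using Cons.prems True
        by (intro arg_cong[of _ _ prod_list] map_cong) (auto simp: unit_exponent_def add_exponents_def)
      ultimately show ?thesis
        unfolding no_less using True
        by (simp add: unit_exponent_def add_exponents_def mult.assoc)
    next
      case False
      then have k: "k < i" "k \<notin> set L" "i \<in> set L"
        using Cons.prems by auto
      then have set_eq: "{j \<in> set (k # L). j < i} = insert k {j \<in> set L. j < i}"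
        by auto
      have "x i * ?m v (k # L) = scale (q k i ^ v k) (x k ^ v k * (x i * ?m v L))"
        by (simp add: mult.assoc[symmetric] x_commute_power scale_mult_left)
      also have "\<dots> = scale (q k i ^ v k * (\<Prod>j\<in>{j\<in>set L. j < i}. q j i ^ v j))
          (x k ^ v k * ?m (unit_exponent i \<oplus> v) L)"
        using Cons k by (simp add: scale_mult_right)
      also have "x k ^ v k = x k ^ (unit_exponent i \<oplus> v) k"
        using False by (simp add: unit_exponent_def add_exponents_def)
      finally show ?thesis
        unfolding set_eq using k by simp
    qed
  qed simp
  from this[of "sorted_list_of_set UNIV"] show ?thesis
    by (simp add: std_monomial_def \<chi>_unit_left)
qed

lemma std_monomial_0: "std_monomial x (\<lambda>i. 0) = 1"
proof -
  have "prod_list (map (\<lambda>i. x i ^ 0) L) = 1" for L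
    by (induction L) auto
  then show ?thesis by (simp add: std_monomial_def)
qed

lemma prod_list_word: "prod_list (map x w) = scale (word_coeff w) (std_monomial x (count_list w))"
  by (induction w)
    (simp_all add: count_list_Nil_exponent std_monomial_0 scale_mult_right x_mult_std_monomial
      count_list_Cons_exponent mult.commute del: count_list.simps)

text \<open>Both factors are words up to nonzero scalars, and words multiply by concatenation.\<close>

lemma std_monomial_mult:
  "std_monomial x u * std_monomial x v = scale (\<chi> u v) (std_monomial x (u \<oplus> v))"
proof -
  obtain r s where w: "count_list r = u" "count_list s = v"
    using ex_word_of_exponent by metis
  have "scale (word_coeff r * word_coeff s) (std_monomial x u * std_monomial x v) =
      prod_list (map x (r @ s))"
    by (simp add: prod_list_word[of r] prod_list_word[of s] w scale_mult_left scale_mult_right)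
  also have "\<dots> = scale (word_coeff r * word_coeff s) (scale (\<chi> u v) (std_monomial x (u \<oplus> v)))"
    by (simp only: prod_list_word word_coeff_append count_list_append_exponent w scale_scale)
  finally show ?thesis
    by (simp only: scale_cancel_left) (simp add: word_coeff_nonzero)
qed

lemma std_monomial_eq_0:
  assumes "v \<notin> exponents a"
  shows "std_monomial x v = 0"
proof -
  obtain i where "\<not> v i \<le> a i - 1"
    using assms by (auto simp: exponents_def)
  then have i: "v i \<ge> a i"
    by simp
  have "x i ^ v i = 0"
    using i x_nilpotent[of i] by (metis le_add_diff_inverse mult_zero_left power_add)
  moreover have "i \<in> set (sorted_list_of_set UNIV)"
    by simp
  then obtain L M where "sorted_list_of_set UNIV = L @ i # M"
    by (meson split_list)
  ultimately show ?thesis by (simp add: std_monomial_def)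
qed

lemma span_std_monomials: "span (std_monomial x ` exponents a) = UNIV"
proof -
  have "y \<in> span (std_monomial x ` exponents a)" for y
  proof -
    obtain p where "y = free_eval scale x p"
      using qci by (auto simp: quantum_complete_intersection_def surj_def)
    moreover have "std_monomial x v \<in> span (std_monomial x ` exponents a)" for v
      by (cases "v \<in> exponents a") (auto simp: std_monomial_eq_0 span_zero intro: span_base)
    ultimately show ?thesis
      by (auto simp: free_eval_def lin_ext_def prod_list_word intro!: span_sum span_scale)
  qed
  then show ?thesis by blast
qed

text \<open>For linear independence, read off from an element of the free algebra the coefficient that its
  class has at \<open>x\<^sub>v\<close>: a word \<open>w\<close> of exponent \<open>v\<close> contributes \<open>word_coeff w\<close>. For \<open>v\<close> in
  \<open>exponents a\<close> this kills the relations, and since \<open>exponents a\<close> is closed under taking smaller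
  exponents, the common kernel is an ideal.\<close>

definition word_functional :: "('i \<Rightarrow> nat) \<Rightarrow> ('k, 'i) free_algebra \<Rightarrow> 'k" where
  "word_functional v =
     lin_ext (*) (\<lambda>w. if count_list (letters w) = v then word_coeff (letters w) else 0)"

lemma word_functional_add: "word_functional v (p + r) = word_functional v p + word_functional v r"
  and word_functional_sum:
    "word_functional v (\<Sum>b\<in>B. g b) = (\<Sum>b\<in>B. word_functional v (g b))"
  and word_functional_single: "word_functional v (Poly_Mapping.single (Word w) c) =
    (if count_list w = v then c * word_coeff w else 0)"
  by (simp_all add: word_functional_def lin_ext_field)

lemma word_functional_eq: "word_functional v p =
  (\<Sum>w\<in>Poly_Mapping.keys p. if count_list (letters w) = v
     then Poly_Mapping.lookup p w * word_coeff (letters w) else 0)"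
  by (simp add: word_functional_def lin_ext_def if_distrib cong: if_cong)

definition below :: "('i \<Rightarrow> nat) \<Rightarrow> ('i \<Rightarrow> nat) \<Rightarrow> bool" where
  "below u v \<longleftrightarrow> (\<forall>i. u i \<le> v i)"

lemma add_exponents_eq_iff: "u \<oplus> w = v \<longleftrightarrow> below u v \<and> w = (\<lambda>i. v i - u i)"
  by (fastforce simp: add_exponents_def below_def fun_eq_iff)

lemma word_functional_single_mult:
  "word_functional v (Poly_Mapping.single (Word w) c * p) =
    (if below (count_list w) v
     then c * word_coeff w * \<chi> (count_list w) (\<lambda>i. v i - count_list w i) *
       word_functional (\<lambda>i. v i - count_list w i) p
     else 0)"
proof -
  have "Poly_Mapping.single (Word w) c * p = (\<Sum>b\<in>Poly_Mapping.keys p.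
      Poly_Mapping.single (Word (w @ letters b)) (c * Poly_Mapping.lookup p b))"
    by (subst poly_mapping_sum_singles[of p])
      (simp add: sum_distrib_left mult_single plus_fmon_def)
  then show ?thesis
    by (auto simp: word_functional_sum word_functional_single count_list_append_exponent
        add_exponents_eq_iff word_coeff_append word_functional_eq[of _ p] sum_distrib_left
        intro!: sum.cong sum.neutral)
qed

lemma word_functional_mult_single:
  "word_functional v (p * Poly_Mapping.single (Word w) c) =
    (if below (count_list w) v
     then c * word_coeff w * \<chi> (\<lambda>i. v i - count_list w i) (count_list w) *
       word_functional (\<lambda>i. v i - count_list w i) p
     else 0)"
proof -
  have "p * Poly_Mapping.single (Word w) c = (\<Sum>b\<in>Poly_Mapping.keys p.
      Poly_Mapping.single (Word (letters b @ w)) (Poly_Mapping.lookup p b * c))"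
    by (subst poly_mapping_sum_singles[of p])
      (simp add: sum_distrib_right mult_single plus_fmon_def)
  then show ?thesis
    by (auto simp: word_functional_sum word_functional_single count_list_append_exponent
        add_exponents_commute[of _ "count_list w"]
        add_exponents_eq_iff word_coeff_append word_functional_eq[of _ p] sum_distrib_left
        intro!: sum.cong sum.neutral)
qed

lemma word_functional_kernel_ideal:
  "two_sided_ideal {p. \<forall>v\<in>exponents a. word_functional v p = 0}" (is "two_sided_ideal ?I")
  unfolding two_sided_ideal_def
proof (intro conjI ballI allI)
  show "0 \<in> ?I"
    by (simp add: word_functional_def lin_ext_field)
  show "p + r \<in> ?I" if "p \<in> ?I" "r \<in> ?I" for p r
    using that by (simp add: word_functional_add)
  fix p r assume p: "p \<in> ?I"
  have box: "(\<lambda>i. v i - u i) \<in> exponents a" if "v \<in> exponents a" for u v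
    using that by (auto simp: exponents_def intro: le_trans[OF diff_le_self])
  have "word_functional v (r * p) = 0" "word_functional v (p * r) = 0" if v: "v \<in> exponents a" for v
  proof -
    have "word_functional v (Poly_Mapping.single b c * p) = 0"
      "word_functional v (p * Poly_Mapping.single b c) = 0" for b c
      using word_functional_single_mult[of v "letters b" c p]
        word_functional_mult_single[of v p "letters b" c] box[OF v] p by auto
    then show "word_functional v (r * p) = 0" "word_functional v (p * r) = 0"
      by (subst poly_mapping_sum_singles[of r];
          simp add: sum_distrib_left sum_distrib_right word_functional_sum)+
  qed
  then show "r * p \<in> ?I" "p * r \<in> ?I"
    by auto
qed

lemma word_functional_eq_0:
  assumes "free_eval scale x p = 0" and "v \<in> exponents a"
  shows "word_functional v p = 0"
proof -
  have "qci_relations q a \<subseteq> {p. \<forall>v\<in>exponents a. word_functional v p = 0}"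
  proof -
    have "word_functional v (gen i ^ a i) = 0" if "v \<in> exponents a" for i v
    proof -
      have count: "count_list (replicate n i) i = n" for n
        by (induction n) auto
      have "v i < a i"
        using that a_ge_2[of i] by (auto simp: exponents_def intro: le_less_trans)
      then have "count_list (replicate (a i) i) \<noteq> v"
        using count by auto
      then show ?thesis by (simp add: gen_power word_functional_single)
    qed
    moreover have "word_functional v (gen j * gen i - fscale (q i j) (gen i * gen j)) = 0" for i j v
    proof -
      have "count_list [j, i] = count_list [i, j]"
        by auto
      moreover have "word_coeff [j, i] = q i j * word_coeff [i, j]"
        by (cases i j rule: linorder_cases)
          (simp_all add: \<chi>_unit_unit count_list_Cons_exponent count_list_Nil_exponent q_inverse q_diag
            del: count_list.simps)
      ultimately show ?thesis
        unfolding gen_mult word_functional_def lin_ext_field by simp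
    qed
    ultimately show ?thesis
      by (auto simp: qci_relations_def)
  qed
  then have "two_sided_ideal hull (qci_relations q a) \<subseteq>
      {p. \<forall>v\<in>exponents a. word_functional v p = 0}"
    by (intro hull_minimal word_functional_kernel_ideal)
  then show ?thesis
    using assms qci by (auto simp: quantum_complete_intersection_def)
qed

lemma finite_exponents: "finite (exponents a)"
proof -
  have "exponents a = (\<Pi>\<^sub>E i\<in>UNIV. {..a i - 1})"
    by (auto simp: exponents_def PiE_def)
  then show ?thesis by (simp add: finite_PiE)
qed

lemma std_monomials_independent:
  assumes "(\<Sum>v\<in>exponents a. scale (c v) (std_monomial x v)) = 0" and "u \<in> exponents a"
  shows "c u = 0"
proof -
  obtain w :: "('i \<Rightarrow> nat) \<Rightarrow> 'i list" where w: "\<And>v. count_list (w v) = v"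
    using ex_word_of_exponent by metis
  define p where "p = (\<Sum>v\<in>exponents a. Poly_Mapping.single (Word (w v)) (c v / word_coeff (w v)))"
  have "free_eval scale x p = 0"
    using assms(1)
    by (simp add: p_def free_eval_def lin_ext_sum prod_list_word w word_coeff_nonzero)
  then have "word_functional u p = 0"
    using assms(2) by (rule word_functional_eq_0)
  then show ?thesis
    using assms(2) finite_exponents
    by (simp add: p_def word_functional_sum word_functional_single w word_coeff_nonzero)
qed

lemma inj_std_monomial: "inj_on (std_monomial x) (exponents a)"
proof (rule inj_onI, rule ccontr)
  fix u v
  assume uv: "u \<in> exponents a" "v \<in> exponents a" "std_monomial x u = std_monomial x v" "u \<noteq> v"
  define c where "c w = (if w = u then 1 else if w = v then - 1 else 0 :: 'k)" for w
  have "(\<Sum>w\<in>exponents a. scale (c w) (std_monomial x w)) =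
      (\<Sum>w\<in>{u, v}. scale (c w) (std_monomial x w))"
    using uv finite_exponents by (intro sum.mono_neutral_right) (auto simp: c_def)
  also have "\<dots> = 0"
    using uv by (simp add: c_def)
  finally have "c u = 0"
    using uv(1) by (rule std_monomials_independent)
  then show False by (simp add: c_def)
qed

lemma independent_std_monomials: "independent (std_monomial x ` exponents a)"
proof (rule independent_if_scalars_zero)
  fix f y
  assume "(\<Sum>y\<in>std_monomial x ` exponents a. scale (f y) y) = 0" "y \<in> std_monomial x ` exponents a"
  then show "f y = 0"
    using std_monomials_independent[of "\<lambda>v. f (std_monomial x v)"]
    by (auto simp: sum.reindex[OF inj_std_monomial])
qed (simp add: finite_exponents)

abbreviation coord :: "('i \<Rightarrow> nat) \<Rightarrow> 'a \<Rightarrow> 'k" where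
  "coord \<equiv> dual_monomial scale x a"

lemma linear_coord: "linear_functional scale (coord v)"
  unfolding linear_functional_def dual_monomial_def
  by (rule linear_representation[OF independent_std_monomials span_std_monomials])

lemma coord_std_monomial:
  assumes "u \<in> exponents a" and "v \<in> exponents a"
  shows "coord u (std_monomial x v) = (if u = v then 1 else 0)"
  using assms inj_std_monomial
  by (auto simp: dual_monomial_def representation_basis[OF independent_std_monomials] inj_on_eq_iff)

lemma coord_expansion: "(\<Sum>v\<in>exponents a. scale (coord v y) (std_monomial x v)) = y"
proof -
  have "(\<Sum>b\<in>std_monomial x ` exponents a.
      scale (representation (std_monomial x ` exponents a) y b) b) = y"
    using independent_std_monomials span_std_monomials finite_exponents
    by (intro sum_representation_eq) auto
  then show ?thesis
    by (simp add: sum.reindex[OF inj_std_monomial] dual_monomial_def)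
qed

lemma functional_expansion:
  assumes "linear_functional scale f"
  shows "f y = (\<Sum>v\<in>exponents a. f (std_monomial x v) * coord v y)"
proof -
  have "f y = f (\<Sum>v\<in>exponents a. scale (coord v y) (std_monomial x v))"
    by (simp only: coord_expansion)
  then show ?thesis
    using assms by (simp add: linear_functional_sum linear_functional_iff mult.commute)
qed

lemma eq_if_coord_eq:
  assumes "\<And>v. v \<in> exponents a \<Longrightarrow> coord v y = coord v z"
  shows "y = z"
  by (subst coord_expansion[of y, symmetric], subst coord_expansion[of z, symmetric])
    (simp add: assms)

lemma coord_std_monomial_mult:
  assumes "v \<in> exponents a"
  shows "coord v (std_monomial x u * std_monomial x w) = (if u \<oplus> w = v then \<chi> u w else 0)"
proof (cases "u \<oplus> w \<in> exponents a")
  case True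
  then show ?thesis
    using assms linear_coord[of v]
    by (auto simp: std_monomial_mult linear_functional_iff coord_std_monomial)
next
  case False
  then have "coord v (std_monomial x u * std_monomial x w) = coord v (scale 0 0)"
    by (simp add: std_monomial_mult std_monomial_eq_0)
  also have "\<dots> = 0"
    using linear_coord[of v] unfolding linear_functional_iff by (metis mult_zero_left)
  finally show ?thesis
    using assms False by auto
qed

lemma coord_mult:
  assumes "v \<in> exponents a"
  shows "coord v (y * z) = (\<Sum>u\<in>exponents a. \<Sum>w\<in>exponents a.
    coord u y * coord w z * (if u \<oplus> w = v then \<chi> u w else 0))"
proof -
  have "y * z = (\<Sum>u\<in>exponents a. \<Sum>w\<in>exponents a.
      scale (coord u y * coord w z) (std_monomial x u * std_monomial x w))"
  proof -
    have "y * z = (\<Sum>u\<in>exponents a. scale (coord u y) (std_monomial x u)) *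
        (\<Sum>w\<in>exponents a. scale (coord w z) (std_monomial x w))"
      by (simp only: coord_expansion)
    then show ?thesis
      by (simp only: sum_product scale_mult_left scale_mult_right scale_scale mult.commute)
  qed
  then have "coord v (y * z) = coord v (\<Sum>u\<in>exponents a. \<Sum>w\<in>exponents a.
      scale (coord u y * coord w z) (std_monomial x u * std_monomial x w))"
    by simp
  then show ?thesis
    using linear_coord[of v] assms
    by (simp add: linear_functional_sum linear_functional_iff coord_std_monomial_mult)
qed

lemma zero_exponent [simp]: "(\<lambda>i. 0) \<in> exponents a"
  and top_exponent [simp]: "top_exponent a \<in> exponents a"
  by (simp_all add: exponents_def top_exponent_def)

lemma unit_exponent [simp]: "unit_exponent i \<in> exponents a"
proof -
  have "1 \<le> a j - 1" for j
    using a_ge_2[of j] by simp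
  then show ?thesis by (simp add: exponents_def unit_exponent_def)
qed

abbreviation coord0 :: "'a \<Rightarrow> 'k" where
  "coord0 \<equiv> coord (\<lambda>i. 0)"

lemma coord_add: "coord v (y + z) = coord v y + coord v z"
  and coord_scale: "coord v (scale c y) = c * coord v y"
  using linear_coord[of v] by (simp_all add: linear_functional_iff)

lemma coord_zero: "coord v 0 = 0"
  using coord_scale[of v 0 0] by simp

lemma coord_one: "coord v 1 = (if v = (\<lambda>i. 0) then 1 else 0)" if "v \<in> exponents a"
  using coord_std_monomial[OF that zero_exponent] by (simp add: std_monomial_0)

lemma sum_add_exponents: "sum (u \<oplus> w) UNIV = sum u UNIV + sum w UNIV"
  for u w :: "'i \<Rightarrow> nat"
  by (simp add: add_exponents_def sum.distrib)

lemma add_exponents_eq_unit_iff: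
  "u \<oplus> w = unit_exponent i \<longleftrightarrow>
    u = unit_exponent i \<and> w = (\<lambda>i. 0) \<or> u = (\<lambda>i. 0) \<and> w = unit_exponent i"
proof
  assume "u \<oplus> w = unit_exponent i"
  then have *: "u j + w j = (if j = i then 1 else 0)" for j
    by (metis add_exponents_def unit_exponent_def)
  show "u = unit_exponent i \<and> w = (\<lambda>i. 0) \<or> u = (\<lambda>i. 0) \<and> w = unit_exponent i"
  proof (cases "u i = 0")
    case True
    then have "u j = 0 \<and> w j = unit_exponent i j" for j
      using *[of j] by (auto simp: unit_exponent_def split: if_splits)
    then show ?thesis by auto
  next
    case False
    then have "w j = 0 \<and> u j = unit_exponent i j" for j
      using *[of j] by (auto simp: unit_exponent_def split: if_splits)
    then show ?thesis by auto
  qed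
qed auto

lemma unit_exponent_neq_0: "unit_exponent i \<noteq> (\<lambda>i. 0)"
  by (metis unit_exponent_def zero_neq_one)

text \<open>In most of the products needed below, a single pair of standard monomials contributes to the
  coefficient in question.\<close>

lemma coord_mult_single_term:
  assumes "v \<in> exponents a" and "u0 \<in> exponents a" and "w0 \<in> exponents a" and "u0 \<oplus> w0 = v"
    and "\<And>u w. \<lbrakk>u \<in> exponents a; w \<in> exponents a; u \<oplus> w = v; coord u y \<noteq> 0; coord w z \<noteq> 0\<rbrakk>
      \<Longrightarrow> u = u0 \<and> w = w0"
  shows "coord v (y * z) = coord u0 y * coord w0 z * \<chi> u0 w0"
proof -
  have "coord v (y * z) = (\<Sum>(u, w)\<in>exponents a \<times> exponents a.
      coord u y * coord w z * (if u \<oplus> w = v then \<chi> u w else 0))"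
    using assms(1) by (simp add: coord_mult sum.cartesian_product)
  also have "\<dots> = (\<Sum>(u, w)\<in>{(u0, w0)}.
      coord u y * coord w z * (if u \<oplus> w = v then \<chi> u w else 0))"
  proof (rule sum.mono_neutral_right)
    show "\<forall>p\<in>exponents a \<times> exponents a - {(u0, w0)}.
        (case p of (u, w) \<Rightarrow> coord u y * coord w z * (if u \<oplus> w = v then \<chi> u w else 0)) = 0"
    proof safe
      fix u w assume "u \<in> exponents a" "w \<in> exponents a"
        "coord u y * coord w z * (if u \<oplus> w = v then \<chi> u w else 0) \<noteq> 0"
      then show "u = u0" "w = w0"
        using assms(5)[of u w] by (simp_all split: if_splits)
    qed
  qed (use finite_exponents assms(2,3) in simp_all)
  finally show ?thesis
    using assms(4) by simp
qed

text \<open>The linear coefficients are derivations at \<open>coord0\<close>. They see the algebra modulo the square of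
  its augmentation ideal, where inner automorphisms act trivially.\<close>

lemma coord_unit_exponent_mult:
  "coord (unit_exponent i) (y * z) =
    coord (unit_exponent i) y * coord0 z + coord0 y * coord (unit_exponent i) z"
proof -
  have "coord (unit_exponent i) (y * z) = (\<Sum>(u, w)\<in>exponents a \<times> exponents a.
      coord u y * coord w z * (if u \<oplus> w = unit_exponent i then \<chi> u w else 0))"
    by (simp add: coord_mult sum.cartesian_product)
  also have "\<dots> = (\<Sum>(u, w)\<in>{(unit_exponent i, \<lambda>i. 0), (\<lambda>i. 0, unit_exponent i)}.
      coord u y * coord w z * (if u \<oplus> w = unit_exponent i then \<chi> u w else 0))"
    using finite_exponents
    by (intro sum.mono_neutral_right) (auto simp: add_exponents_eq_unit_iff split: if_splits)
  finally show ?thesis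
    using unit_exponent_neq_0[of i] by simp
qed

definition homogeneous :: "nat \<Rightarrow> 'a set" where
  "homogeneous d = span {std_monomial x u | u. u \<in> exponents a \<and> sum u UNIV = d}"

lemma coord_homogeneous:
  assumes "y \<in> homogeneous d" and "v \<in> exponents a" and "sum v UNIV \<noteq> d"
  shows "coord v y = 0"
  using assms(1) unfolding homogeneous_def
proof (induction rule: span_induct_alt)
  case base
  then show ?case by (rule coord_zero)
next
  case (step c b y)
  then show ?case
    using assms(2,3) by (auto simp: coord_add coord_scale coord_std_monomial split: if_splits)
qed

text \<open>A factor of positive degree would push \<open>y\<close> above degree \<open>d\<close>, so only the constant term of \<open>z\<close>
  can contribute.\<close>

lemma coord_mult_homogeneous:
  assumes "y \<in> homogeneous d" and "v \<in> exponents a" and "sum v UNIV = d"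
  shows "coord v (y * z) = coord v y * coord0 z" and "coord v (z * y) = coord0 z * coord v y"
proof -
  have "w = (\<lambda>i. 0)" if "sum w UNIV = 0" for w :: "'i \<Rightarrow> nat"
    using that by (simp add: fun_eq_iff)
  moreover have "sum u UNIV = d" if "u \<in> exponents a" "coord u y \<noteq> 0" for u
    using coord_homogeneous[OF assms(1)] that by blast
  ultimately have *: "u = v \<and> w = (\<lambda>i. 0)"
    if "u \<in> exponents a" "u \<oplus> w = v \<or> w \<oplus> u = v" "coord u y \<noteq> 0" for u w
    using that assms(3) sum_add_exponents[of u w] add_exponents_commute[of u w]
    by (metis add_cancel_right_right add_exponents_0(1))
  have "coord v (y * z) = coord v y * coord0 z * \<chi> v (\<lambda>i. 0)"
    using * assms(2) by (intro coord_mult_single_term) auto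
  then show "coord v (y * z) = coord v y * coord0 z"
    by simp
  have "coord v (z * y) = coord0 z * coord v y * \<chi> (\<lambda>i. 0) v"
    using * assms(2) by (intro coord_mult_single_term) auto
  then show "coord v (z * y) = coord0 z * coord v y"
    by simp
qed

text \<open>The top exponent is the largest one, so every monomial other than \<open>1\<close> kills the top monomial.\<close>

lemma top_monomial_mult:
  "std_monomial x (top_exponent a) * y = scale (coord0 y) (std_monomial x (top_exponent a))"
  "y * std_monomial x (top_exponent a) = scale (coord0 y) (std_monomial x (top_exponent a))"
proof -
  let ?T = "std_monomial x (top_exponent a)"
  have not_box: "top_exponent a \<oplus> v \<notin> exponents a" if v: "v \<noteq> (\<lambda>i. 0)" for v
  proof -
    obtain i where "v i \<noteq> 0" using v by auto
    then show ?thesis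
      by (auto simp: exponents_def top_exponent_def add_exponents_def intro!: exI[of _ i])
  qed
  have T: "?T * std_monomial x v = (if v = (\<lambda>i. 0) then ?T else 0)"
    "std_monomial x v * ?T = (if v = (\<lambda>i. 0) then ?T else 0)" for v
    using not_box[of v]
    by (auto simp: std_monomial_mult std_monomial_eq_0 add_exponents_commute[of v])
  have sum: "(\<Sum>v\<in>exponents a. scale (coord v y) (if v = (\<lambda>i. 0) then ?T else 0)) = scale (coord0 y) ?T"
    by (simp add: if_distrib[of "scale _"] finite_exponents cong: if_cong)
  have "?T * y = ?T * (\<Sum>v\<in>exponents a. scale (coord v y) (std_monomial x v))"
    "y * ?T = (\<Sum>v\<in>exponents a. scale (coord v y) (std_monomial x v)) * ?T"
    by (simp_all only: coord_expansion)
  then show "?T * y = scale (coord0 y) ?T" "y * ?T = scale (coord0 y) ?T"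
    by (simp_all only: sum_distrib_left sum_distrib_right scale_mult_left scale_mult_right T sum)
qed

text \<open>Every factor from the augmentation ideal raises the lowest degree, and degrees are bounded by that
  of the top monomial.\<close>

lemma augmentation_nilpotent:
  assumes "coord0 m = 0"
  obtains k where "m ^ k = 0"
proof -
  have low: "coord v (m ^ k) = 0" if "v \<in> exponents a" "sum v UNIV < k" for v k
    using that
  proof (induction k arbitrary: v)
    case (Suc k)
    have zero: "coord u m * coord w (m ^ k) * (if u \<oplus> w = v then \<chi> u w else 0) = 0"
      if "u \<in> exponents a" "w \<in> exponents a" for u w
    proof (cases "u \<oplus> w = v \<and> u \<noteq> (\<lambda>i. 0)")
      case True
      then have "sum u UNIV > 0"
        by (auto simp: fun_eq_iff sum_pos2)
      with True have "sum w UNIV < k"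
        using Suc.prems(2) sum_add_exponents[of u w] by simp
      then show ?thesis
        using Suc.IH that by simp
    qed (use assms in auto)
    show ?case
      unfolding power_Suc coord_mult[OF Suc.prems(1)] by (intro sum.neutral ballI zero)
  qed simp
  have deg: "sum v UNIV < Suc (sum (top_exponent a) UNIV)" if "v \<in> exponents a" for v
    using that by (auto simp: exponents_def top_exponent_def less_Suc_eq_le intro: sum_mono)
  have "m ^ Suc (sum (top_exponent a) UNIV) = 0"
    by (rule eq_if_coord_eq) (simp add: low deg coord_zero del: power_Suc)
  then show thesis by (rule that)
qed

text \<open>After scaling, \<open>w\<close> is \<open>1 - m\<close> with \<open>m\<close> nilpotent, and the geometric series inverts it.\<close>

lemma unit_elements_if_coord0:
  assumes "coord0 w \<noteq> 0"
  shows "w \<in> unit_elements"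
proof -
  define c where "c = inverse (coord0 w)"
  define m where "m = 1 - scale c w"
  have "scale c w = 1 - m" by (simp add: m_def)
  have "coord0 m + coord0 (scale c w) = coord0 1"
    by (simp add: m_def flip: coord_add)
  then have "coord0 m = 0"
    using assms by (simp add: c_def coord_scale coord_one)
  then obtain k where k: "m ^ k = 0" by (rule augmentation_nilpotent)
  have geometric: "(1 - m) * (\<Sum>i<k. m ^ i) = 1 - m ^ k" "(\<Sum>i<k. m ^ i) * (1 - m) = 1 - m ^ k" for k
  proof (induction k)
    case (Suc k)
    {
      case 1
      then show ?case using Suc by (simp add: distrib_left) (simp add: algebra_simps)
    next
      case 2
      then show ?case
        using Suc by (simp add: distrib_right) (simp add: algebra_simps power_commutes)
    }
  qed simp_all
  define s where "s = scale c (\<Sum>i<k. m ^ i)"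
  have "w * s = scale c w * (\<Sum>i<k. m ^ i)" "s * w = (\<Sum>i<k. m ^ i) * scale c w"
    by (simp_all only: s_def scale_mult_right scale_mult_left)
  then have "w * s = 1" "s * w = 1"
    unfolding \<open>scale c w = 1 - m\<close> geometric k by simp_all
  then show ?thesis by (auto simp: unit_elements_def)
qed

text \<open>The generators are nilpotent, so every character with values in the field kills them.\<close>

lemma character_eq_coord0:
  assumes lin: "linear_functional scale f" and mult: "\<And>y z. f (y * z) = f y * f z" and "f 1 = 1"
  shows "f = coord0"
proof -
  have pow: "f (y ^ n) = f y ^ n" for y n
    by (induction n) (simp_all add: mult \<open>f 1 = 1\<close>)
  have fx: "f (x i) = 0" for i
  proof -
    have "f 0 = 0"
      using lin unfolding linear_functional_iff by (metis mult_zero_left scale_zero_left)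
    then show ?thesis
      using pow[of "x i" "a i"] a_ge_2[of i] by (simp add: x_nilpotent)
  qed
  have "f (std_monomial x v) = coord0 (std_monomial x v)" if v: "v \<in> exponents a" for v
  proof (cases "v = (\<lambda>i. 0)")
    case True
    then show ?thesis by (simp add: std_monomial_0 coord_one \<open>f 1 = 1\<close>)
  next
    case False
    obtain w where w: "count_list w = v"
      using ex_word_of_exponent by metis
    with False obtain i w' where "w = i # w'"
      by (cases w) auto
    then have "f (prod_list (map x w)) = 0"
      by (simp add: mult fx)
    then have "f (scale (word_coeff w) (std_monomial x v)) = 0"
      by (simp only: prod_list_word w)
    then show ?thesis
      using lin False v by (simp add: linear_functional_iff word_coeff_nonzero coord_std_monomial)
  qed
  then have "f y = coord0 y" for y
    by (subst functional_expansion[OF lin], subst functional_expansion[OF linear_coord])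
      (simp cong: sum.cong)
  then show ?thesis by auto
qed

lemma linear_map_eqI:
  assumes "\<And>y z. f (y + z) = f y + f z" and "\<And>c y. f (scale c y) = scale c (f y)"
    and "\<And>y z. g (y + z) = g y + g z" and "\<And>c y. g (scale c y) = scale c (g y)"
    and "\<And>v. v \<in> exponents a \<Longrightarrow> f (std_monomial x v) = g (std_monomial x v)"
  shows "f = g"
proof
  fix y
  have "f 0 = 0" "g 0 = 0"
    using assms(2)[of 0 0] assms(4)[of 0 0] by simp_all
  have "y \<in> span (std_monomial x ` exponents a)"
    by (simp add: span_std_monomials)
  then show "f y = g y"
    by (induction rule: span_induct_alt) (auto simp: assms \<open>f 0 = 0\<close> \<open>g 0 = 0\<close>)
qed

lemma algebra_endomorphism_eq_id:
  assumes add: "\<And>y z. N (y + z) = N y + N z" and sc: "\<And>c y. N (scale c y) = scale c (N y)"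
    and mult: "\<And>y z. N (y * z) = N y * N z" and one: "N 1 = 1" and gens: "\<And>i. N (x i) = x i"
  shows "N = id"
proof -
  have word: "N (prod_list (map x w)) = prod_list (map x w)" for w
    by (induction w) (simp_all add: one mult gens)
  have "N (std_monomial x v) = std_monomial x v" for v
  proof -
    obtain w where "count_list w = v"
      using ex_word_of_exponent by metis
    then show ?thesis
      using word[of w] word_coeff_nonzero[of w] by (simp add: prod_list_word sc)
  qed
  then show ?thesis
    by (intro linear_map_eqI) (simp_all add: add sc)
qed

lemma std_monomial_unit_exponent: "std_monomial x (unit_exponent i) = x i"
  using prod_list_word[of "[i]"]
  by (simp add: count_list_Cons_exponent count_list_Nil_exponent del: count_list.simps)

end

section \<open>Bi-Frobenius structures on quantum complete intersections\<close>

text \<open>The description that defines \<open>nakayama\<close> is unique for a nondegenerate form.\<close>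

lemma nakayama_eqI:
  assumes "algebra_automorphism scale N" and N: "\<And>y z. \<psi> (y * z) = \<psi> (z * N y)"
    and nondegenerate: "\<And>b c. (\<And>y. \<psi> (y * b) = \<psi> (y * c)) \<Longrightarrow> b = c"
  shows "nakayama scale \<psi> = N"
  unfolding nakayama_def
proof (rule the_equality)
  fix M assume "algebra_automorphism scale M \<and> (\<forall>y z. \<psi> (y * z) = \<psi> (z * M y))"
  then have M: "\<psi> (y * z) = \<psi> (z * M y)" for y z by simp
  show "M = N"
  proof
    fix y show "M y = N y"
      by (rule nondegenerate) (metis M N)
  qed
qed (use assms in simp)

locale bi_frobenius_quantum_complete_intersection =
  quantum_complete_intersection_algebra scale x q a + bi_frobenius_algebra scale \<Delta> \<epsilon> \<phi> t S
  for scale :: "'k::field \<Rightarrow> 'a::ring_1 \<Rightarrow> 'a" and x :: "'i::{finite,linorder} \<Rightarrow> 'a"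
    and q a \<Delta> \<epsilon> \<phi> t S
begin

abbreviation T :: 'a where
  "T \<equiv> std_monomial x (top_exponent a)"

lemma counit_eq_coord0: "\<epsilon> = coord0"
  by (rule character_eq_coord0) (simp_all add: linear_counit counit_mult counit_one)

lemma top_eq: "T = scale (\<phi> T) t"
  using right_integral_iff[of T] by (simp add: top_monomial_mult(1) counit_eq_coord0)

lemma form_top_nonzero: "\<phi> T \<noteq> 0"
proof
  assume "\<phi> T = 0"
  then have "T = 0" using top_eq by simp
  then show False
    using coord_std_monomial[OF top_exponent top_exponent] by (simp add: coord_zero)
qed

lemma t_eq: "t = scale (inverse (\<phi> T)) T"
  using form_top_nonzero by (subst top_eq) simp

end

text \<open>The one-dimensional socle \<open>\<K> x\<^bsub>a-1\<^esub>\<close> consists of two-sided integrals.\<close>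

sublocale bi_frobenius_quantum_complete_intersection \<subseteq> unimodular_bi_frobenius_algebra scale \<Delta> \<epsilon> \<phi> t S
proof
  show "y * t = scale (\<epsilon> y) t" for y
    by (subst (1 2) t_eq) (simp add: scale_mult_right top_monomial_mult(2) counit_eq_coord0 mult.commute)
qed

context bi_frobenius_quantum_complete_intersection
begin

lemma unit_elements_if_counit: "\<epsilon> w \<noteq> 0 \<Longrightarrow> w \<in> unit_elements"
  using unit_elements_if_coord0 by (simp add: counit_eq_coord0)

lemma right_integrals_eq: "right_integrals scale \<epsilon> = {scale c T | c. True}"
proof -
  have "s \<in> right_integrals scale \<epsilon> \<longleftrightarrow> (\<exists>c. s = scale c T)" for s
  proof
    assume "s \<in> right_integrals scale \<epsilon>"
    then have "s = scale (\<phi> s) t"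
      unfolding right_integrals_def using right_integral_iff by blast
    then have "s = scale (\<phi> s * inverse (\<phi> T)) T"
      using t_eq by (metis scale_scale)
    then show "\<exists>c. s = scale c T" ..
  next
    assume "\<exists>c. s = scale c T"
    then show "s \<in> right_integrals scale \<epsilon>"
      by (auto simp: right_integrals_def scale_mult_left top_monomial_mult(1) counit_eq_coord0 mult.commute)
  qed
  then show ?thesis by auto
qed

lemma left_integrals_eq: "left_integrals scale \<epsilon> = {scale c T | c. True}"
proof -
  have "s \<in> left_integrals scale \<epsilon> \<longleftrightarrow> (\<exists>c. s = scale c T)" for s
  proof
    assume s: "s \<in> left_integrals scale \<epsilon>"
    have "s = scale (\<phi> s) t"
    proof (rule form_nondegenerate)
      show "\<phi> (y * s) = \<phi> (y * scale (\<phi> s) t)" for y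
        using s by (simp add: left_integrals_def scale_mult_right form_mult_t
            functional_scale_eq[OF linear_form] mult.commute)
    qed
    then have "s = scale (\<phi> s * inverse (\<phi> T)) T"
      using t_eq by (metis scale_scale)
    then show "\<exists>c. s = scale c T" ..
  next
    assume "\<exists>c. s = scale c T"
    then show "s \<in> left_integrals scale \<epsilon>"
      by (auto simp: left_integrals_def scale_mult_right top_monomial_mult(2) counit_eq_coord0 mult.commute)
  qed
  then show ?thesis by auto
qed

lemma nakayama_form: "nakayama scale \<phi> = (\<lambda>y. S_inv (S_inv y))"
proof (rule nakayama_eqI)
  have "bij (\<lambda>y. S_inv (S_inv y))"
    by (rule bij_betw_byWitness[of _ "\<lambda>y. S (S y)"]) auto
  moreover have "Vector_Spaces.linear scale scale (\<lambda>y. S_inv (S_inv y))"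
    by unfold_locales (simp_all add: linear_S_inv)
  ultimately show "algebra_automorphism scale (\<lambda>y. S_inv (S_inv y))"
    by (simp add: algebra_automorphism_def S_inv_one S_inv_mult)
qed (rule form_nakayama, rule form_nondegenerate)

text \<open>Since \<open>\<phi>\<close> is a Frobenius form, the top coefficient is \<open>\<phi> \<leftharpoonup> w\<close> for some \<open>w\<close>. Its value at the
  top monomial is \<open>\<epsilon> w\<close> times a scalar, so \<open>w\<close> is a unit.\<close>

lemma coord_top_eq:
  obtains w z where "w * z = 1" and "z * w = 1" and "\<And>y. coord (top_exponent a) y = \<phi> (w * y)"
    and "\<And>y. \<phi> y = coord (top_exponent a) (z * y)"
proof -
  obtain w where w: "coord (top_exponent a) = \<phi> \<leftharpoonup>\<^sub>d w"
    using functional_form_mult[OF linear_coord] by blast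
  have "1 = \<phi> (w * T)"
    using w coord_std_monomial[OF top_exponent top_exponent] by (simp add: dual_ract_def)
  then have "\<epsilon> w \<noteq> 0"
    by (auto simp: top_monomial_mult(2) counit_eq_coord0 functional_0_eq[OF linear_form])
  then obtain z where z: "w * z = 1" "z * w = 1"
    using unit_elements_if_counit by (auto simp: unit_elements_def)
  have top: "coord (top_exponent a) y = \<phi> (w * y)" for y
    by (simp add: w dual_ract_def)
  have "\<phi> y = \<phi> ((w * z) * y)" for y
    by (simp add: z)
  then have "\<phi> y = coord (top_exponent a) (z * y)" for y
    by (simp only: top mult.assoc)
  with z top show thesis
    by (rule that)
qed

lemma graded_antipode_homogeneous:
  assumes "graded_map scale x a S" and "y \<in> homogeneous d"
  shows "S y \<in> homogeneous d"
proof -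
  have "S 0 = 0"
    using linear_antipode(2)[of 0 0] by simp
  show ?thesis
    using assms(2) unfolding homogeneous_def
  proof (induction rule: span_induct_alt)
    case base
    then show ?case by (simp add: \<open>S 0 = 0\<close> span_zero)
  next
    case (step c b y)
    then have "S b \<in> span {std_monomial x u | u. u \<in> exponents a \<and> sum u UNIV = d}"
      using assms(1) by (auto simp: graded_map_def)
    then show ?case
      using step by (simp add: linear_antipode span_add span_scale)
  qed
qed

text \<open>The scalars by which the canonical Nakayama automorphism acts on the standard basis.\<close>

definition nakayama_scalar :: "('i \<Rightarrow> nat) \<Rightarrow> 'k" where
  "nakayama_scalar v =
     \<chi> v (\<lambda>i. top_exponent a i - v i) / \<chi> (\<lambda>i. top_exponent a i - v i) v"

lemma coord_top_commute:
  assumes "v \<in> exponents a"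
  shows "coord (top_exponent a) (std_monomial x v * y) =
    nakayama_scalar v * coord (top_exponent a) (y * std_monomial x v)"
proof -
  let ?\<psi> = "coord (top_exponent a)"
  have "?\<psi> (std_monomial x v * std_monomial x u) =
      nakayama_scalar v * ?\<psi> (std_monomial x u * std_monomial x v)" for u
  proof (cases "v \<oplus> u = top_exponent a")
    case True
    moreover from this have "u \<oplus> v = top_exponent a"
      by (simp add: add_exponents_commute)
    moreover have "nakayama_scalar v = \<chi> v u / \<chi> u v"
      using True by (simp add: add_exponents_eq_iff nakayama_scalar_def)
    ultimately show ?thesis
      by (simp add: coord_std_monomial_mult \<chi>_nonzero)
  next
    case False
    then show ?thesis
      by (simp add: coord_std_monomial_mult add_exponents_commute[of u])
  qed
  note basis = this
  have lin: "functional (\<lambda>y. ?\<psi> (std_monomial x v * y))"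
    "functional (\<lambda>y. nakayama_scalar v * ?\<psi> (y * std_monomial x v))"
    by (simp_all add: linear_functional_iff coord_add coord_scale distrib_left distrib_right
        scale_mult_left scale_mult_right mult.left_commute)
  show ?thesis
    using functional_expansion[OF lin(1), of y] functional_expansion[OF lin(2), of y]
    by (simp only: basis)
qed

lemma nakayama_scalar_unit_exponent:
  "h_coeff q a (unit_vector i) = inverse (nakayama_scalar (unit_exponent i))"
proof -
  have "int (a j) - 1 - unit_vector i j = int (top_exponent a j - unit_exponent i j)" for j
    using a_ge_2[of j]
    by (auto simp: top_exponent_def unit_exponent_def unit_vector_def of_nat_diff)
  moreover have "unit_vector i = (\<lambda>j. int (unit_exponent i j))"
    by (auto simp: unit_vector_def unit_exponent_def)
  ultimately show ?thesis
    by (simp add: h_coeff_def nakayama_scalar_def \<chi>_def)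
qed

text \<open>As the two Frobenius forms differ by the unit \<open>w\<close>, the canonical Nakayama automorphism \<open>N\<close> is
  \<open>S\<^sup>-\<^sup>2\<close> followed by an inner automorphism. Modulo the square of the augmentation ideal it therefore
  acts as \<open>S\<^sup>-\<^sup>2\<close>, which acts there as its inverse \<open>S\<^sup>2\<close> because \<open>S\<^sup>4\<close> is inner. Since \<open>N\<close> is diagonal
  in the standard basis, its eigenvalue on each generator squares to one.\<close>

lemma canonical_nakayama:
  defines "N \<equiv> canonical_nakayama scale x a"
  obtains w where "\<epsilon> w \<noteq> 0" and "\<And>y. S (S (N y)) * w = w * y"
    and "N \<circ> N = id" and "\<And>i. (h_coeff q a (unit_vector i))\<^sup>2 = 1"
    and "\<And>v. v \<in> exponents a \<Longrightarrow> N (std_monomial x v) = scale (nakayama_scalar v) (std_monomial x v)"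
    and "\<And>y z. N (y + z) = N y + N z" and "\<And>c y. N (scale c y) = scale c (N y)"
proof -
  obtain w z where wz: "w * z = 1" "z * w = 1"
    and w: "\<And>y. coord (top_exponent a) y = \<phi> (w * y)"
    by (rule coord_top_eq) blast
  define W where "W = S_inv (S_inv w)"
  define Z where "Z = S_inv (S_inv z)"
  have WZ: "W * Z = 1" "Z * W = 1"
    by (simp_all add: W_def Z_def S_inv_one wz flip: S_inv_mult)
  \<comment> \<open>The Nakayama automorphism of \<open>\<phi> \<leftharpoonup> w\<close>, computed from that of \<open>\<phi>\<close>.\<close>
  define M where "M = (\<lambda>y. W * S_inv (S_inv y) * Z)"
  have M_lin: "M (y + y') = M y + M y'" "M (scale c y) = scale c (M y)" for y y' c
    by (simp_all add: M_def linear_S_inv distrib_left distrib_right scale_mult_left scale_mult_right)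
  have M_mult: "M (y * y') = M y * M y'" for y y'
  proof -
    have "M y * M y' = W * S_inv (S_inv y) * (Z * W) * S_inv (S_inv y') * Z"
      by (simp only: M_def mult.assoc)
    then show ?thesis by (simp add: WZ M_def S_inv_mult mult.assoc)
  qed
  have M_one: "M 1 = 1"
    by (simp add: M_def S_inv_one WZ)
  have MW: "M y * W = W * S_inv (S_inv y)" for y
    by (simp add: M_def mult.assoc WZ)
  have SSM: "S (S (M y)) * w = w * y" for y
  proof -
    have "S (S (M y * W)) = w * y"
      unfolding MW by (simp add: antipode_mult W_def)
    then show ?thesis by (simp add: antipode_mult W_def)
  qed
  have nondegenerate: "b = c"
    if "\<And>y. coord (top_exponent a) (y * b) = coord (top_exponent a) (y * c)" for b c
  proof (rule form_nondegenerate)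
    show "\<phi> (y * b) = \<phi> (y * c)" for y
      using that[of "z * y"] wz by (simp add: w mult.assoc[symmetric])
  qed
  have M_nakayama: "coord (top_exponent a) (y * y') = coord (top_exponent a) (y' * M y)" for y y'
  proof -
    have "\<phi> (w * y * y') = \<phi> (y' * (W * S_inv (S_inv y)))"
      by (subst form_nakayama) (simp add: S_inv_mult W_def)
    also have "\<dots> = \<phi> (w * (y' * M y))"
      by (subst form_nakayama[of w]) (simp add: W_def[symmetric] MW mult.assoc)
    finally show ?thesis by (simp add: w mult.assoc)
  qed
  have "algebra_automorphism scale M"
  proof -
    have "Vector_Spaces.linear scale scale M"
      by unfold_locales (simp_all add: M_lin)
    moreover have "bij M"
    proof (rule bij_betw_byWitness[of _ "\<lambda>y. S (S (Z * y * W))"])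
      have "Z * (W * y * Z) * W = y" "W * (Z * y * W) * Z = y" for y
      proof -
        have "Z * (W * y * Z) * W = (Z * W) * y * (Z * W)" "W * (Z * y * W) * Z = (W * Z) * y * (W * Z)"
          by (simp_all only: mult.assoc)
        then show "Z * (W * y * Z) * W = y" "W * (Z * y * W) * Z = y"
          by (simp_all add: WZ)
      qed
      then show "\<forall>y\<in>UNIV. S (S (Z * M y * W)) = y" "\<forall>y\<in>UNIV. M (S (S (Z * y * W))) = y"
        unfolding M_def by simp_all
    qed auto
    ultimately show ?thesis
      by (simp add: algebra_automorphism_def M_one M_mult)
  qed
  then have N: "N = M"
    unfolding N_def canonical_nakayama_def by (rule nakayama_eqI) (rule M_nakayama, rule nondegenerate)
  have M_std: "M (std_monomial x v) = scale (nakayama_scalar v) (std_monomial x v)"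
    if "v \<in> exponents a" for v
  proof (rule nondegenerate)
    show "coord (top_exponent a) (y * M (std_monomial x v)) =
        coord (top_exponent a) (y * scale (nakayama_scalar v) (std_monomial x v))" for y
      using coord_top_commute[OF that, of y]
      by (simp add: scale_mult_right coord_scale flip: M_nakayama)
  qed
  have "\<epsilon> w * \<epsilon> z = 1"
    by (simp add: wz counit_one flip: counit_mult)
  then have ew: "\<epsilon> w \<noteq> 0"
    by auto
  have square: "nakayama_scalar (unit_exponent i) * nakayama_scalar (unit_exponent i) = 1" for i
  proof -
    let ?\<kappa> = "nakayama_scalar (unit_exponent i)" and ?c = "coord (unit_exponent i)"
    have x: "?c (x i) = 1" "\<epsilon> (x i) = 0"
      using coord_std_monomial[of "unit_exponent i" "unit_exponent i"]
        coord_std_monomial[of "\<lambda>i. 0" "unit_exponent i"] unit_exponent_neq_0[of i]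
      by (simp_all add: std_monomial_unit_exponent counit_eq_coord0)
    have prod: "?c (y * y') = ?c y * \<epsilon> y' + \<epsilon> y * ?c y'" for y y'
      by (simp add: coord_unit_exponent_mult counit_eq_coord0)
    have Mx: "M (x i) = scale ?\<kappa> (x i)"
      using M_std[of "unit_exponent i"] by (simp add: std_monomial_unit_exponent)
    have "?c (S (S (x i)) * \<aa>) = ?c (\<aa> * S_inv (S_inv (x i)))"
      by (simp only: antipode_square_modular)
    then have same: "?c (S (S (x i))) = ?c (S_inv (S_inv (x i)))"
      by (simp add: prod counit_modular_element counit_antipode counit_S_inv x)
    have "?c (scale ?\<kappa> (S (S (x i))) * w) = ?c (w * x i)"
      using SSM[of "x i"] by (simp add: Mx linear_antipode)
    then have 1: "?\<kappa> * ?c (S (S (x i))) * \<epsilon> w = \<epsilon> w"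
      by (simp add: prod x coord_scale counit_antipode functional_scale_eq[OF linear_counit])
    have "?c (scale ?\<kappa> (x i) * W) = ?c (W * S_inv (S_inv (x i)))"
      using MW[of "x i"] by (simp add: Mx)
    then have 2: "?\<kappa> * \<epsilon> w = \<epsilon> w * ?c (S_inv (S_inv (x i)))"
      by (simp add: prod x coord_scale counit_S_inv functional_scale_eq[OF linear_counit] W_def)
    from 2 have "?c (S_inv (S_inv (x i))) = ?\<kappa>"
      using ew by (metis mult.commute mult_left_cancel)
    with 1 have "(?\<kappa> * ?\<kappa>) * \<epsilon> w = 1 * \<epsilon> w"
      by (simp only: same mult_1)
    then show ?thesis
      using ew mult_right_cancel by blast
  qed
  have "M \<circ> M = id"
  proof (rule algebra_endomorphism_eq_id)
    have "M (x i) = scale (nakayama_scalar (unit_exponent i)) (x i)" for i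
      using M_std[of "unit_exponent i"] by (simp add: std_monomial_unit_exponent)
    then show "(M \<circ> M) (x i) = x i" for i
      by (simp add: M_lin square)
  qed (simp_all add: M_lin M_mult M_one)
  moreover have h: "(h_coeff q a (unit_vector i))\<^sup>2 = 1" for i
    using square[of i] unfolding nakayama_scalar_unit_exponent power2_eq_square
    by (metis inverse_1 inverse_mult_distrib)
  ultimately show thesis
    by (rule that[of w, unfolded N, OF ew SSM _ _ M_std M_lin])
qed

text \<open>A graded antipode is compared with the canonical Nakayama automorphism in lowest degree, where
  the conjugating unit acts as a scalar.\<close>

lemma graded_antipode_square:
  assumes "graded_map scale x a S"
  shows "S \<circ> S = canonical_nakayama scale x a" and "S ^^ 4 = id"
proof -
  let ?N = "canonical_nakayama scale x a"
  obtain w where ew: "\<epsilon> w \<noteq> 0" and conj: "\<And>y. S (S (?N y)) * w = w * y" and NN: "?N \<circ> ?N = id"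
    and N_std: "\<And>v. v \<in> exponents a \<Longrightarrow>
      ?N (std_monomial x v) = scale (nakayama_scalar v) (std_monomial x v)"
    and N_lin: "\<And>y z. ?N (y + z) = ?N y + ?N z" "\<And>c y. ?N (scale c y) = scale c (?N y)"
    by (rule canonical_nakayama) blast
  have SSN: "(\<lambda>y. S (S (?N y))) = (\<lambda>y. y)"
  proof (rule linear_map_eqI)
    fix v assume v: "v \<in> exponents a"
    let ?d = "sum v UNIV" and ?y = "S (S (?N (std_monomial x v)))"
    have hom: "std_monomial x v \<in> homogeneous ?d"
      unfolding homogeneous_def using v by (intro span_base) auto
    then have "?N (std_monomial x v) \<in> homogeneous ?d"
      unfolding N_std[OF v] homogeneous_def by (rule span_scale)
    then have hom': "?y \<in> homogeneous ?d"
      by (intro graded_antipode_homogeneous assms)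
    show "?y = std_monomial x v"
    proof (rule eq_if_coord_eq)
      fix u assume u: "u \<in> exponents a"
      show "coord u ?y = coord u (std_monomial x v)"
      proof (cases "sum u UNIV = ?d")
        case True
        have "coord u (?y * w) = coord u (w * std_monomial x v)"
          by (simp only: conj)
        then show ?thesis
          using ew coord_mult_homogeneous[OF hom u True] coord_mult_homogeneous[OF hom' u True]
          by (simp add: counit_eq_coord0)
      next
        case False
        then show ?thesis
          using coord_homogeneous[OF hom u] coord_homogeneous[OF hom' u] by simp
      qed
    qed
  qed (simp_all add: N_lin linear_antipode)
  show SS: "S \<circ> S = ?N"
  proof
    fix y
    have "?N (?N y) = y"
      using NN by (simp add: fun_eq_iff)
    then show "(S \<circ> S) y = ?N y"
      using SSN by (metis comp_apply)
  qed
  have "S ^^ 4 = (S \<circ> S) \<circ> (S \<circ> S)"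
    by (simp add: eval_nat_numeral fun_eq_iff)
  then show "S ^^ 4 = id"
    by (simp only: SS NN)
qed

text \<open>The augmentation ideal is nilpotent, so \<open>\<aa>\<close> is unipotent and therefore trivial in
  characteristic zero.\<close>

lemma char_0_antipode:
  assumes "CHAR('k) = 0"
  shows "\<aa> = 1" and "nakayama scale \<phi> \<circ> nakayama scale \<phi> = id" and "S ^^ 4 = id"
proof -
  have "coord0 (\<aa> - 1) + coord0 1 = coord0 \<aa>"
    by (simp flip: coord_add)
  then have "coord0 (\<aa> - 1) = 0"
    using counit_modular_element by (simp add: counit_eq_coord0 coord_one)
  then obtain j where "(\<aa> - 1) ^ j = 0"
    by (rule augmentation_nilpotent)
  moreover have "\<aa> \<in> unit_elements"
    by (rule unit_elements_if_counit) (simp add: counit_modular_element)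
  ultimately show "\<aa> = 1"
    using assms by (intro modular_element_eq_one)
  then have *: "\<forall>y. S (S y) = S_inv (S_inv y)"
    using antipode_square_modular by simp
  then show "S ^^ 4 = id"
    by (simp add: antipode_power_4_iff)
  have "S_inv (S_inv (S_inv (S_inv y))) = y" for y
    using *[rule_format, of "S_inv (S_inv y)"] by simp
  then show "nakayama scale \<phi> \<circ> nakayama scale \<phi> = id"
    by (simp add: nakayama_form fun_eq_iff)
qed

end

theorem proposition4p1:
  fixes scale :: "'k::field \<Rightarrow> 'a::ring_1 \<Rightarrow> 'a"
    and x :: "'i::{finite,linorder} \<Rightarrow> 'a"
    and q :: "'i \<Rightarrow> 'i \<Rightarrow> 'k"
    and a :: "'i \<Rightarrow> nat"
    and \<Delta> :: "'a \<Rightarrow> ('a \<times> 'a \<Rightarrow>\<^sub>0 'k)"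
    and \<epsilon> \<phi> :: "'a \<Rightarrow> 'k"
    and t :: 'a
    and S :: "'a \<Rightarrow> 'a"
  assumes "CARD('i) \<ge> 2"
    and "\<And>i. a i \<ge> 2"
    and "\<And>i. q i i = 1"
    and "\<And>i j. q i j * q j i = 1"
    and "quantum_complete_intersection scale x q a"
    and "bi_frobenius scale \<Delta> \<epsilon> \<phi> t S"
  shows
    "((\<exists>z\<in>unit_elements. \<phi> = dual_monomial scale x a (top_exponent a) \<leftharpoonup>\<^sub>d z) \<and>
      (\<exists>c. \<phi> = (\<lambda>y. \<Sum>v\<in>exponents a. c v * dual_monomial scale x a v y) \<and>
           c (top_exponent a) \<noteq> 0)) \<and>
     (modular_function \<phi> t = \<epsilon> \<and>
      (\<forall>v\<in>exponents a. \<epsilon> (std_monomial x v) = (if v = (\<lambda>i. 0) then 1 else 0))) \<and>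
     ((\<exists>c. c \<noteq> 0 \<and> t = scale c (std_monomial x (top_exponent a))) \<and>
      unimodular scale \<epsilon> \<and>
      right_integrals scale \<epsilon> = {scale c (std_monomial x (top_exponent a)) | c. True}) \<and>
     (canonical_nakayama scale x a \<circ> canonical_nakayama scale x a = id \<and>
      (\<forall>i. (h_coeff q a (unit_vector i))\<^sup>2 = 1)) \<and>
     (graded_map scale x a S \<longrightarrow> S \<circ> S = canonical_nakayama scale x a \<and> S ^^ 4 = id) \<and>
     (CHAR('k) = 0 \<longrightarrow>
      modular_element scale \<Delta> \<phi> t = 1 \<and>
      nakayama scale \<phi> \<circ> nakayama scale \<phi> = id \<and> S ^^ 4 = id)"
proof -
  interpret bi_frobenius_quantum_complete_intersection scale x q a \<Delta> \<epsilon> \<phi> t S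
    using assms(2-6)
    by (simp add: bi_frobenius_quantum_complete_intersection_def bi_frobenius_algebra_def
        quantum_complete_intersection_algebra_def)
  have "\<exists>z\<in>unit_elements. \<phi> = dual_monomial scale x a (top_exponent a) \<leftharpoonup>\<^sub>d z"
  proof -
    obtain w z where "w * z = 1" "z * w = 1" "\<And>y. \<phi> y = coord (top_exponent a) (z * y)"
      by (rule coord_top_eq) blast
    then show ?thesis
      by (intro bexI[of _ z]) (auto simp: dual_ract_def unit_elements_def)
  qed
  moreover have "\<exists>c. \<phi> = (\<lambda>y. \<Sum>v\<in>exponents a. c v * dual_monomial scale x a v y) \<and>
      c (top_exponent a) \<noteq> 0"
    by (intro exI[of _ "\<lambda>v. \<phi> (std_monomial x v)"] conjI ext functional_expansion linear_form
        form_top_nonzero)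
  moreover have "modular_function \<phi> t = \<epsilon>"
    by (simp add: modular_function_def dual_lact_def form_mult_t)
  moreover have "\<forall>v\<in>exponents a. \<epsilon> (std_monomial x v) = (if v = (\<lambda>i. 0) then 1 else 0)"
    by (auto simp: counit_eq_coord0 coord_std_monomial)
  moreover have "\<exists>c. c \<noteq> 0 \<and> t = scale c (std_monomial x (top_exponent a))"
    using t_eq form_top_nonzero nonzero_imp_inverse_nonzero by blast
  moreover have "unimodular scale \<epsilon>"
    by (simp add: unimodular_def right_integrals_eq left_integrals_eq)
  moreover have "canonical_nakayama scale x a \<circ> canonical_nakayama scale x a = id"
    "(h_coeff q a (unit_vector i))\<^sup>2 = 1" for i
    using canonical_nakayama by metis+
  ultimately show ?thesis
    using right_integrals_eq graded_antipode_square char_0_antipode by blast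
qed

end
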